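(* Assume that $X$ is in Class 1 or Class 2 and let $x\in I$, $x<\eta$. Then $H_\eta$ is finite $\mathbf P_x$-a.s., and the distribution of $D^-_{H_\eta}$ is given, for $0\le y\le\eta-l$, by $$\mathbf P_x(D^-_{H_\eta}<y)=\exp\left(-\int_{x\vee(y+l)}^{\eta}\frac{S(dz)}{S(z)-S(z-y)}\right).$$
   Context: $X=(X_t)_{t\ge 0}$ is a regular one-dimensional diffusion in the sense of Itô and McKean (strong Markov, continuous paths) on an interval $I\subseteq\mathbb R$ with left endpoint $l\ge-\infty$ and right endpoint $r=+\infty$, not killed inside $I$. $\mathbf P_x$ denotes probability when $X_0=x$. $S$ is the scale function, assumed continuously differentiable, and the speed measure $m$ is assumed to have a continuous density with respect to Lebesgue measure. Class 1: $X$ is recurrent with either (a) $S(+\infty)=+\infty$, $S(l)=-\infty$, or (b) $S(+\infty)=+\infty$, $S(l)>-\infty$, $l>-\infty$ and $l$ reflecting. Class 2: $X$ is transient with either (a) $S(+\infty)<\infty$, $S(l)=-\infty$, or (b) $S(+\infty)<\infty$, $S(l)>-\infty$, $l>-\infty$ and $l$ reflecting. $M_t:=\max_{0\le s\le t}X_s$, $D^-_t:=\max_{0\le s\le t}(M_s-X_s)$ (maximum drawdown up to time $t$), $H_\eta:=\inf\{t\ge0:X_t=\eta\}$. $S(dz)=dS(z)$, $a\vee b=\max(a,b)$; if $l=-\infty$ then $x\vee(y+l)=x$ and the condition on $y$ is $0\le y<\infty$. For $y=0$ the integral is $+\infty$ and $\exp(-\infty)=0$. *)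

theory Defs
  imports "HOL-Probability.Probability"
begin

section \<open>Functionals of the path\<close>

text \<open>Paths are maps from time (the reals, of which only \<open>t \<ge> 0\<close> matters) to the extended reals.
  The hitting time is \<open>top = \<infinity>\<close> if the level is never attained (infimum of the empty set).\<close>

definition hitting_time :: "(real \<Rightarrow> 'w \<Rightarrow> ereal) \<Rightarrow> real \<Rightarrow> 'w \<Rightarrow> ennreal" where
  "hitting_time X y \<omega> = (INF t\<in>{t. 0 \<le> t \<and> X t \<omega> = ereal y}. ennreal t)"

definition running_max :: "(real \<Rightarrow> 'w \<Rightarrow> ereal) \<Rightarrow> real \<Rightarrow> 'w \<Rightarrow> ereal" where
  "running_max X t \<omega> = (SUP s\<in>{0..t}. X s \<omega>)"

definition max_drawdown :: "(real \<Rightarrow> 'w \<Rightarrow> ereal) \<Rightarrow> real \<Rightarrow> 'w \<Rightarrow> ereal" where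
  "max_drawdown X t \<omega> = (SUP s\<in>{0..t}. running_max X s \<omega> - X s \<omega>)"

section \<open>One-dimensional diffusions\<close>

text \<open>\<open>P x\<close> is the law under which the process starts at \<open>x \<in> I\<close>. The right endpoint of the state
  interval is \<open>+\<infinity>\<close>. The diffusion may leave \<open>I\<close> only by converging to an endpoint that is not in
  \<open>I\<close> (such as \<open>+\<infinity>\<close>, in case of explosion), and it then stays there; there is no killing in \<open>I\<close>.
  A time \<open>\<tau> \<omega> = top\<close> is mapped to \<open>0\<close> by \<open>enn2real\<close>, but the strong Markov property only
  speaks about \<open>\<tau> \<omega> < top\<close>.

  Regularity asks that every interior point can be reached from every point of \<open>I\<close>. An endpoint
  \<open>l \<in> I\<close> need not be reachable, so that entrance boundaries may belong to \<open>I\<close>.\<close>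

locale ito_mckean_diffusion = filtration "space M" F
  for M :: "'w measure" and F :: "ennreal \<Rightarrow> 'w measure" +
  fixes P :: "real \<Rightarrow> 'w measure"
    and X :: "real \<Rightarrow> 'w \<Rightarrow> ereal"
    and I :: "real set"
    and l :: ereal
  assumes interval: "is_interval I" "I \<noteq> {}"
    and left_endpoint: "l = (INF z\<in>I. ereal z)"
    and right_endpoint: "(SUP z\<in>I. ereal z) = \<infinity>"
    and filtration_sub: "\<And>t. subalgebra M (F t)"
    and adapted: "\<And>t. 0 \<le> t \<Longrightarrow> X t \<in> borel_measurable (F (ennreal t))"
    and kernel: "P \<in> restrict_space borel I \<rightarrow>\<^sub>M prob_algebra M"
    and start: "\<And>x. x \<in> I \<Longrightarrow> AE \<omega> in P x. X 0 \<omega> = ereal x"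
    and continuous_paths: "\<And>\<omega>. \<omega> \<in> space M \<Longrightarrow> continuous_on {0..} (\<lambda>t. X t \<omega>)"
    and state_space: "\<And>\<omega> t. \<omega> \<in> space M \<Longrightarrow> 0 \<le> t \<Longrightarrow> X t \<omega> \<in> ereal ` I \<union> {l, \<infinity>}"
    and not_killed_inside: "\<And>\<omega> s t. \<omega> \<in> space M \<Longrightarrow> 0 \<le> s \<Longrightarrow> s \<le> t \<Longrightarrow>
          X s \<omega> \<notin> ereal ` I \<Longrightarrow> X t \<omega> = X s \<omega>"
    and strong_markov: "\<And>x \<tau> A B.
          x \<in> I \<Longrightarrow> stopping_time F \<tau> \<Longrightarrow> A \<in> sets (pre_sigma \<tau>) \<Longrightarrow>
          B \<in> sets (\<Pi>\<^sub>M t\<in>{0..}. borel) \<Longrightarrow>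
          emeasure (P x) {\<omega>\<in>A. \<tau> \<omega> < top \<and> X (enn2real (\<tau> \<omega>)) \<omega> \<in> ereal ` I \<and>
                              (\<lambda>t\<in>{0..}. X (enn2real (\<tau> \<omega>) + t) \<omega>) \<in> B}
          = (\<integral>\<^sup>+\<omega>\<in>{\<omega>\<in>A. \<tau> \<omega> < top \<and> X (enn2real (\<tau> \<omega>)) \<omega> \<in> ereal ` I}.
               emeasure (P (real_of_ereal (X (enn2real (\<tau> \<omega>)) \<omega>)))
                 {\<omega>'\<in>space M. (\<lambda>t\<in>{0..}. X t \<omega>') \<in> B} \<partial>P x)"
    and regular: "\<And>x y. x \<in> I \<Longrightarrow> y \<in> interior I \<Longrightarrow>
          \<P>(\<omega> in P x. hitting_time X y \<omega> < top) > 0"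

definition recurrent :: "(real \<Rightarrow> 'w measure) \<Rightarrow> (real \<Rightarrow> 'w \<Rightarrow> ereal) \<Rightarrow> real set \<Rightarrow> bool" where
  "recurrent P X I \<longleftrightarrow>
     (\<forall>x\<in>I. \<forall>y\<in>interior I. \<P>(\<omega> in P x. hitting_time X y \<omega> < top) = 1)"

definition transient :: "(real \<Rightarrow> 'w measure) \<Rightarrow> (real \<Rightarrow> 'w \<Rightarrow> ereal) \<Rightarrow> real set \<Rightarrow> bool" where
  "transient P X I \<longleftrightarrow> \<not> recurrent P X I"

section \<open>Scale function and speed measure\<close>

text \<open>The scale function matters on the interior of \<open>I\<close> only; its values elsewhere are arbitrary.\<close>

definition is_scale_function ::
  "(real \<Rightarrow> 'w measure) \<Rightarrow> (real \<Rightarrow> 'w \<Rightarrow> ereal) \<Rightarrow> real set \<Rightarrow> (real \<Rightarrow> real) \<Rightarrow> bool" where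
  "is_scale_function P X I S \<longleftrightarrow>
     continuous_on (interior I) S \<and> strict_mono_on (interior I) S \<and>
     (\<forall>a\<in>interior I. \<forall>b\<in>interior I. \<forall>x. a < x \<and> x < b \<longrightarrow>
        \<P>(\<omega> in P x. hitting_time X b \<omega> < hitting_time X a \<omega>) = (S x - S a) / (S b - S a))"

text \<open>The limits of the scale function at the endpoints, which exist by monotonicity.\<close>

definition scale_left :: "real set \<Rightarrow> (real \<Rightarrow> real) \<Rightarrow> ereal" where
  "scale_left I S = (INF z\<in>interior I. ereal (S z))"

definition scale_right :: "real set \<Rightarrow> (real \<Rightarrow> real) \<Rightarrow> ereal" where
  "scale_right I S = (SUP z\<in>interior I. ereal (S z))"

text \<open>The measure \<open>S(dz)\<close>; this is the Stieltjes measure of \<open>S\<close> since \<open>S\<close> is assumed to be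
  continuously differentiable.\<close>

definition scale_stieltjes :: "real set \<Rightarrow> (real \<Rightarrow> real) \<Rightarrow> real measure" where
  "scale_stieltjes I S = density lborel (\<lambda>z. ennreal (deriv S z) * indicator (interior I) z)"

text \<open>Speed measure, in the normalisation in which standard Brownian motion with \<open>S z = z\<close> has
  speed measure \<open>2 dz\<close>: it represents the expected exit times from intervals \<open>(a, b)\<close> by means of the
  Green function. The second identity determines its mass at a left endpoint belonging to \<open>I\<close>.\<close>

definition is_speed_measure :: "(real \<Rightarrow> 'w measure) \<Rightarrow> (real \<Rightarrow> 'w \<Rightarrow> ereal) \<Rightarrow> real set \<Rightarrow> ereal \<Rightarrow>
    (real \<Rightarrow> real) \<Rightarrow> real measure \<Rightarrow> bool" where
  "is_speed_measure P X I l S m \<longleftrightarrow>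
     sets m = sets borel \<and> emeasure m (- I) = 0 \<and>
     (\<forall>a\<in>interior I. \<forall>b\<in>interior I. \<forall>x. a < x \<and> x < b \<longrightarrow>
        (\<integral>\<^sup>+\<omega>. min (hitting_time X a \<omega>) (hitting_time X b \<omega>) \<partial>P x) =
        (\<integral>\<^sup>+z\<in>{a<..<b}.
           ennreal ((S (min x z) - S a) * (S b - S (max x z)) / (S b - S a)) \<partial>m)) \<and>
     (\<forall>a\<in>I. l = ereal a \<longrightarrow>
        (\<forall>x\<in>interior I. \<forall>b. x < b \<longrightarrow>
           (\<integral>\<^sup>+\<omega>. hitting_time X b \<omega> \<partial>P x) =
           (\<integral>\<^sup>+z\<in>{a..<b}. ennreal (S b - S (max x z)) \<partial>m)))"

definition has_continuous_density :: "real set \<Rightarrow> real measure \<Rightarrow> bool" where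
  "has_continuous_density I m \<longleftrightarrow>
     (\<exists>\<rho>. continuous_on (interior I) \<rho> \<and> (\<forall>z\<in>interior I. 0 \<le> \<rho> z) \<and>
        (\<forall>A\<in>sets borel. A \<subseteq> interior I \<longrightarrow>
           emeasure m A = (\<integral>\<^sup>+z\<in>A. ennreal (\<rho> z) \<partial>lborel)))"

text \<open>A reflecting endpoint can be reached from, and left to, the interior, and carries no mass of
  the speed measure (a positive mass means that it is sticky).\<close>

definition reflecting :: "(real \<Rightarrow> 'w measure) \<Rightarrow> (real \<Rightarrow> 'w \<Rightarrow> ereal) \<Rightarrow> real set \<Rightarrow> ereal \<Rightarrow>
    real measure \<Rightarrow> bool" where
  "reflecting P X I l m \<longleftrightarrow>
     (\<exists>a\<in>I. l = ereal a \<and>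
        (\<exists>x\<in>interior I. \<P>(\<omega> in P x. hitting_time X a \<omega> < top) > 0) \<and>
        (\<exists>y\<in>interior I. \<P>(\<omega> in P a. hitting_time X y \<omega> < top) > 0) \<and>
        emeasure m {a} = 0)"

section \<open>The two classes\<close>

definition class1 :: "(real \<Rightarrow> 'w measure) \<Rightarrow> (real \<Rightarrow> 'w \<Rightarrow> ereal) \<Rightarrow> real set \<Rightarrow> ereal \<Rightarrow>
    (real \<Rightarrow> real) \<Rightarrow> real measure \<Rightarrow> bool" where
  "class1 P X I l S m \<longleftrightarrow> recurrent P X I \<and>
     (scale_right I S = \<infinity> \<and> scale_left I S = -\<infinity> \<or>
      scale_right I S = \<infinity> \<and> scale_left I S > -\<infinity> \<and> l > -\<infinity> \<and> reflecting P X I l m)"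

definition class2 :: "(real \<Rightarrow> 'w measure) \<Rightarrow> (real \<Rightarrow> 'w \<Rightarrow> ereal) \<Rightarrow> real set \<Rightarrow> ereal \<Rightarrow>
    (real \<Rightarrow> real) \<Rightarrow> real measure \<Rightarrow> bool" where
  "class2 P X I l S m \<longleftrightarrow> transient P X I \<and>
     (scale_right I S < \<infinity> \<and> scale_left I S = -\<infinity> \<or>
      scale_right I S < \<infinity> \<and> scale_left I S > -\<infinity> \<and> l > -\<infinity> \<and> reflecting P X I l m)"

section \<open>The exponential of a possibly infinite integral\<close>

definition exp_neg :: "ennreal \<Rightarrow> real" where
  "exp_neg u = (if u = top then 0 else exp (- enn2real u))"

end

theory Submission
  imports Defs
begin

text \<open>
  Fix \<open>y > 0\<close>, and for \<open>z \<le> w\<close> let \<open>g(z, w)\<close> be the probability, starting at \<open>z\<close>, that the level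
  \<open>w\<close> is reached before any drawdown of size \<open>y\<close> has occurred. At the first passage through an
  intermediate level \<open>v\<close> the path stands at its running maximum, so drawdowns before and after that
  moment do not interact, and the strong Markov property makes \<open>g\<close> multiplicative:
  \<open>g(z, w) = g(z, v) g(v, w)\<close> (\<open>climb_prob_mult\<close>). While the path moves from \<open>z\<close> to \<open>w\<close>, its running
  maximum lies between \<open>z\<close> and \<open>w\<close>. Hence a drawdown below \<open>y\<close> is implied by not having touched \<open>w - y\<close>
  and implies not having touched \<open>z - y\<close>, and the scale function gives
  \<open>1 - (S(w) - S(z)) / (S(w) - S(w - y)) \<le> g(z, w) \<le> 1 - (S(w) - S(z)) / (S(w) - S(z - y))\<close>,
  for \<open>z < w < z + y\<close> (\<open>climb_prob_lower\<close>, \<open>climb_prob_upper\<close>). As \<open>w\<close> and \<open>z\<close> approach each other the two bounds agree to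
  first order, so \<open>h(w) = g(a, w)\<close> solves \<open>h' = - h S' / (S - S(\<cdot> - y))\<close>. This linear equation has the
  exponential formula as its solution (\<open>exp_decay_from_increments\<close>).

  The differential equation is available only above \<open>c = max x (y + l)\<close>. Below that level there is no room
  for a drawdown of size \<open>y\<close>, so \<open>g(x, c) = 1\<close> (\<open>climb_prob_no_room\<close>). Since \<open>c - y\<close> may be the endpoint
  \<open>l\<close>, where \<open>S\<close> is arbitrary or singular, the equation is solved on \<open>[w, \<eta>]\<close> with \<open>w > c\<close> and then \<open>w\<close>
  decreases to \<open>c\<close>; the lower bound gives \<open>g(c, w) \<rightarrow> 1\<close>, and the integrals converge monotonically
  (\<open>climb_prob_eq\<close>).

  That \<open>\<eta>\<close> is hit almost surely has two reasons. If \<open>S(l) = -\<infinity>\<close>, the probability of reaching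
  \<open>\<eta>\<close> from an interior point before \<open>a\<close> tends to \<open>1\<close> as \<open>a\<close> decreases to \<open>l\<close> (\<open>hits_AE_scale\<close>). If \<open>l\<close> belongs to the state space, every path
  from \<open>l\<close> to \<open>\<eta>\<close> passes each intermediate point, so the chance of reaching \<open>\<eta>\<close> within a fixed time is
  bounded below uniformly in the starting point, and the tail of the hitting time decays geometrically
  (\<open>hits_AE_bottom\<close>).

  The measure-theoretic side rests on one observation: for a continuous path, reaching \<open>w\<close> by time \<open>t\<close>
  with drawdown at most \<open>d\<close> is a condition on the values at rational times in \<open>[0, t]\<close>
  (\<open>climbs_by_iff_rat\<close>). This one description yields stopping times for the given filtration, which need
  not be right-continuous, events of the pre-\<open>\<sigma>\<close>-algebra at a hitting time, and events of the product
  \<open>\<sigma>\<close>-algebra on path space, as the strong Markov property demands.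
\<close>

section \<open>Drawdown and first passage of a single path\<close>

definition drawdown_le :: "(real \<Rightarrow> ereal) \<Rightarrow> real \<Rightarrow> ereal \<Rightarrow> bool" where
  "drawdown_le p T c \<longleftrightarrow> (\<forall>s u. 0 \<le> s \<longrightarrow> s \<le> u \<longrightarrow> u \<le> T \<longrightarrow> p s \<le> p u + c)"

definition climbs_by :: "(real \<Rightarrow> ereal) \<Rightarrow> real \<Rightarrow> ereal \<Rightarrow> real \<Rightarrow> bool" where
  "climbs_by p w c t \<longleftrightarrow> (\<exists>T\<in>{0..t}. p T = ereal w \<and> drawdown_le p T c)"

text \<open>The bound \<open>c < y\<close> is existential, so that this says that the maximum drawdown at a visit of \<open>w\<close>, a
supremum, is strictly below \<open>y\<close>. The first visit is the least restrictive one, hence any visit will do.\<close>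

definition climbs :: "(real \<Rightarrow> ereal) \<Rightarrow> real \<Rightarrow> real \<Rightarrow> bool" where
  "climbs p w y \<longleftrightarrow> (\<exists>c t. 0 \<le> c \<and> c < y \<and> 0 \<le> t \<and> climbs_by p w (ereal c) t)"

lemma climbsI:
  assumes "0 \<le> c" "c < y" "0 \<le> T" "p T = ereal w" "drawdown_le p T (ereal c)"
  shows "climbs p w y"
proof -
  have "climbs_by p w (ereal c) T" using assms(3-5) unfolding climbs_by_def by auto
  with assms(1-3) show ?thesis unfolding climbs_def by blast
qed

definition rat_upto :: "real \<Rightarrow> real set" where
  "rat_upto t = {q \<in> \<rat>. 0 \<le> q \<and> q \<le> t}"

definition drawdown_le_rat :: "(real \<Rightarrow> ereal) \<Rightarrow> real \<Rightarrow> ereal \<Rightarrow> bool" where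
  "drawdown_le_rat p T c \<longleftrightarrow> (\<forall>u\<in>rat_upto T. \<forall>s\<in>rat_upto u. p s \<le> p u + c)"

definition climbs_by_rat :: "(real \<Rightarrow> ereal) \<Rightarrow> real \<Rightarrow> ereal \<Rightarrow> real \<Rightarrow> bool" where
  "climbs_by_rat p w c t \<longleftrightarrow> (\<forall>k::nat. \<exists>q\<in>rat_upto t.
     ereal (w - 1 / Suc k) < p q \<and> p q < ereal (w + 1 / Suc k) \<and> drawdown_le_rat p q c)"

lemma countable_rat_upto: "countable (rat_upto t)"
  unfolding rat_upto_def by (rule countable_subset[OF _ countable_rat]) auto

lemma climbs_by_rat_sets:
  fixes Z :: "real \<Rightarrow> 'w \<Rightarrow> ereal"
  assumes Z: "\<And>q. 0 \<le> q \<Longrightarrow> q \<le> t \<Longrightarrow> Z q \<in> borel_measurable N"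
  shows "{\<omega>\<in>space N. climbs_by_rat (\<lambda>q. Z q \<omega>) w c t} \<in> sets N"
proof -
  have Z': "Z q \<in> borel_measurable N" if "q \<in> rat_upto t" for q
    using Z that by (auto simp: rat_upto_def)
  have sub: "s \<in> rat_upto u" if "s \<in> rat_upto q" "q \<in> rat_upto u" for s q u
    using that by (auto simp: rat_upto_def)
  have dd: "Measurable.pred N (\<lambda>\<omega>. drawdown_le_rat (\<lambda>q. Z q \<omega>) q c)" if q: "q \<in> rat_upto t" for q
    unfolding drawdown_le_rat_def
  proof (intro measurable_pred_countable countable_rat_upto)
    fix u s assume u: "u \<in> rat_upto q" and s: "s \<in> rat_upto u"
    note [measurable] = Z'[OF sub[OF u q]] Z'[OF sub[OF s sub[OF u q]]]
    show "Measurable.pred N (\<lambda>\<omega>. Z s \<omega> \<le> Z u \<omega> + c)" by measurable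
  qed
  have "Measurable.pred N (\<lambda>\<omega>. climbs_by_rat (\<lambda>q. Z q \<omega>) w c t)"
    unfolding climbs_by_rat_def
  proof (intro pred_intros_countable measurable_pred_countable countable_rat_upto)
    fix k :: nat and q assume q: "q \<in> rat_upto t"
    note [measurable] = Z'[OF q] dd[OF q]
    show "Measurable.pred N (\<lambda>\<omega>. ereal (w - 1 / Suc k) < Z q \<omega> \<and> Z q \<omega> < ereal (w + 1 / Suc k) \<and>
        drawdown_le_rat (\<lambda>q. Z q \<omega>) q c)" by measurable
  qed
  then show ?thesis by (simp add: pred_def)
qed

lemma continuous_add_const_ereal:
  fixes p :: "'a::topological_space \<Rightarrow> ereal"
  assumes "continuous_on A p" "0 \<le> c"
  shows "continuous_on A (\<lambda>u. p u + c)"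
proof (cases c)
  case (real r)
  have "((\<lambda>u. p u + c) \<longlongrightarrow> p x + c) (at x within A)" if "x \<in> A" for x
    using assms(1) that real unfolding continuous_on_def
    by (intro tendsto_add_left_ereal) auto
  then show ?thesis by (auto simp: continuous_on_def)
qed (use assms in auto)

lemma le_by_rational_density:
  fixes f g :: "real \<Rightarrow> 'b::linorder_topology"
  assumes f: "continuous_on {a..b} f" and g: "continuous_on {a..b} g" and "a < b"
    and le: "\<And>q. q \<in> \<rat> \<Longrightarrow> a < q \<Longrightarrow> q < b \<Longrightarrow> f q \<le> g q"
    and x: "x \<in> {a..b}"
  shows "f x \<le> g x"
proof (rule ccontr)
  assume "\<not> f x \<le> g x"
  define C where "C = {a..b} \<inter> (\<lambda>x. (f x, g x)) -` {(u, v) |u v. u \<le> v}"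
  have C: "z \<in> C \<longleftrightarrow> z \<in> {a..b} \<and> f z \<le> g z" for z by (auto simp: C_def)
  have "closed C"
    unfolding C_def
    by (rule continuous_closed_preimage) (use f g closed_subdiagonal in \<open>auto intro: continuous_on_Pair\<close>)
  moreover have "x \<in> - C" using \<open>\<not> f x \<le> g x\<close> C by simp
  ultimately obtain e where e: "e > 0" "ball x e \<subseteq> - C"
    using open_Compl open_contains_ball by metis
  have "max a (x - e) < min b (x + e)"
    using x e \<open>a < b\<close> by auto
  then obtain q where q: "q \<in> \<rat>" "max a (x - e) < q" "q < min b (x + e)"
    using Rats_dense_in_real by blast
  then have "f q \<le> g q" "q \<in> ball x e" "q \<in> {a..b}"
    using le by (auto simp: dist_real_def)
  with e C show False by auto
qed

lemma drawdown_le_of_rat: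
  assumes p: "continuous_on {0..} p" and c: "0 \<le> c" and rat: "drawdown_le_rat p T c"
  shows "drawdown_le p T c"
  unfolding drawdown_le_def
proof (intro allI impI)
  fix s u :: real assume su: "0 \<le> s" "s \<le> u" "u \<le> T"
  have cont: "continuous_on {a..b} p" "continuous_on {a..b} (\<lambda>u. p u + c)" if "0 \<le> a" for a b
    using p continuous_add_const_ereal[OF p c] that
    by (auto elim!: continuous_on_subset)
  show "p s \<le> p u + c"
  proof (cases "s = u")
    case True
    then show ?thesis using add_left_mono[OF c, of "p u"] by simp
  next
    case False
    with su have "s < u" by simp
    have *: "p r \<le> p u + c" if r: "r \<in> \<rat>" "s < r" "r < u" for r
    proof (rule le_by_rational_density[where a=r and b=u and f="\<lambda>_. p r" and g="\<lambda>v. p v + c"])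
      fix q assume "q \<in> \<rat>" "r < q" "q < u"
      with r su rat show "p r \<le> p q + c"
        by (auto simp: drawdown_le_rat_def rat_upto_def)
    qed (use r su cont in auto)
    show ?thesis
      by (rule le_by_rational_density[where a=s and b=u and f=p and g="\<lambda>_. p u + c"])
         (use \<open>s < u\<close> su cont * in auto)
  qed
qed

lemma drawdown_le_mono: "drawdown_le p T c \<Longrightarrow> T' \<le> T \<Longrightarrow> c \<le> c' \<Longrightarrow> drawdown_le p T' c'"
  unfolding drawdown_le_def by (meson add_left_mono order_trans)

text \<open>This is the source of all measurability below. Both directions use that a bound on the drawdown passes to
limits of times. If the rational times come arbitrarily close to \<open>w\<close>, then by compactness of \<open>[0, t]\<close>
they accumulate at a time \<open>T\<close> with \<open>p T = w\<close>, and the bound on the drawdown survives up to \<open>T\<close>. With \<open>c = \<infinity>\<close> the statement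
describes the event that \<open>w\<close> is hit by time \<open>t\<close>.\<close>

lemma climbs_by_iff_rat:
  assumes p: "continuous_on {0..} p" and c: "0 \<le> c" and t: "0 \<le> t"
  shows "climbs_by p w c t \<longleftrightarrow> climbs_by_rat p w c t"
proof
  assume "climbs_by p w c t"
  then obtain T where T: "0 \<le> T" "T \<le> t" "p T = ereal w" "drawdown_le p T c"
    by (auto simp: climbs_by_def)
  have dd: "drawdown_le_rat p q c" if "q \<le> T" for q
    using T(4) that by (auto simp: drawdown_le_rat_def drawdown_le_def rat_upto_def)
  show "climbs_by_rat p w c t"
    unfolding climbs_by_rat_def
  proof
    fix k :: nat
    let ?U = "{ereal (w - 1 / Suc k) <..< ereal (w + 1 / Suc k)}"
    show "\<exists>q\<in>rat_upto t. ereal (w - 1 / Suc k) < p q \<and> p q < ereal (w + 1 / Suc k) \<and>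
        drawdown_le_rat p q c"
    proof (cases "T = 0")
      case True
      with T dd show ?thesis by (intro bexI[of _ 0]) (auto simp: rat_upto_def)
    next
      case False
      have "(p \<longlongrightarrow> p T) (at T within {0..})"
        using p T(1) unfolding continuous_on_def by blast
      moreover have "open ?U" "p T \<in> ?U" using T by auto
      ultimately have "\<forall>\<^sub>F s in at T within {0..}. p s \<in> ?U"
        by (rule topological_tendstoD)
      then obtain d where d: "d > 0" "\<And>s. s \<ge> 0 \<Longrightarrow> s \<noteq> T \<Longrightarrow> dist s T < d \<Longrightarrow> p s \<in> ?U"
        by (auto simp: eventually_at)
      have "max 0 (T - d) < T" using d T False by auto
      then obtain q where q: "q \<in> \<rat>" "max 0 (T - d) < q" "q < T"
        using Rats_dense_in_real by blast
      have "p q \<in> ?U" using d(2)[of q] q by (auto simp: dist_real_def)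
      with q T dd[of q] show ?thesis by (intro bexI[of _ q]) (auto simp: rat_upto_def)
    qed
  qed
next
  assume R: "climbs_by_rat p w c t"
  then obtain q where q: "\<And>k::nat. q k \<in> rat_upto t"
    "\<And>k. ereal (w - 1 / Suc k) < p (q k)" "\<And>k. p (q k) < ereal (w + 1 / Suc k)"
    "\<And>k. drawdown_le_rat p (q k) c"
    unfolding climbs_by_rat_def by metis
  have q0: "q k \<in> {0..t}" for k using q(1)[of k] by (auto simp: rat_upto_def)
  have dd: "drawdown_le p (q k) c" for k
    using drawdown_le_of_rat[OF p c q(4)] .
  obtain T r where T: "T \<in> {0..t}" and r: "strict_mono r" "(q \<circ> r) \<longlonglongrightarrow> T"
    using compact_Icc[of 0 t] q0 unfolding compact_def by metis
  have "(\<lambda>k. p (q (r k))) \<longlonglongrightarrow> p T"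
    by (rule continuous_on_tendsto_compose[OF p]) (use r T q0 in \<open>auto simp: o_def\<close>)
  moreover have "(\<lambda>k. p (q k)) \<longlonglongrightarrow> ereal w"
  proof (rule tendsto_sandwich)
    show "\<forall>\<^sub>F k in sequentially. ereal (w - 1 / Suc k) \<le> p (q k)"
      "\<forall>\<^sub>F k in sequentially. p (q k) \<le> ereal (w + 1 / Suc k)"
      using q(2,3) by (simp_all add: less_imp_le)
    have "(\<lambda>k. w - 1 / Suc k) \<longlonglongrightarrow> w - 0" "(\<lambda>k. w + 1 / Suc k) \<longlonglongrightarrow> w + 0"
      by (intro tendsto_intros LIMSEQ_Suc lim_1_over_n)+
    then show "(\<lambda>k. ereal (w - 1 / Suc k)) \<longlonglongrightarrow> ereal w" "(\<lambda>k. ereal (w + 1 / Suc k)) \<longlonglongrightarrow> ereal w"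
      by auto
  qed
  then have "(\<lambda>k. p (q (r k))) \<longlonglongrightarrow> ereal w"
    using LIMSEQ_subseq_LIMSEQ[OF _ r(1)] by (auto simp: o_def)
  ultimately have pT: "p T = ereal w"
    using LIMSEQ_unique by blast
  have before: "p s \<le> p u + c" if "0 \<le> s" "s \<le> u" "u < T" for s u
  proof -
    have "\<forall>\<^sub>F k in sequentially. u < (q \<circ> r) k"
      using r(2) that(3) by (rule order_tendstoD)
    then obtain k where "u < q (r k)" by (auto simp: eventually_sequentially)
    with dd[of "r k"] that show ?thesis by (auto simp: drawdown_le_def)
  qed
  have "drawdown_le p T c"
    unfolding drawdown_le_def
  proof (intro allI impI)
    fix s u :: real assume su: "0 \<le> s" "s \<le> u" "u \<le> T"
    show "p s \<le> p u + c"
    proof (cases "s = u")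
      case True
      then show ?thesis using add_left_mono[OF c, of "p u"] by simp
    next
      case False
      show ?thesis
        by (rule le_by_rational_density[where a=s and b=u and f="\<lambda>_. p s" and g="\<lambda>v. p v + c"])
           (use False su before p continuous_add_const_ereal[OF p c] in
             \<open>auto elim!: continuous_on_subset\<close>)
    qed
  qed
  with T pT show "climbs_by p w c t" by (auto simp: climbs_by_def)
qed

text \<open>Countably many levels, cofinal below \<open>y\<close>, replace the real bound in \<open>climbs\<close>. The truncation at \<open>0\<close>
keeps them admissible for \<open>climbs_by_iff_rat\<close>.\<close>

definition level_below :: "real \<Rightarrow> nat \<Rightarrow> real" where
  "level_below y n = max 0 (y - 1 / Suc n)"

lemma level_below_nonneg: "0 \<le> level_below y n"
  by (simp add: level_below_def)

lemma level_below_less: "0 < y \<Longrightarrow> level_below y n < y"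
  by (simp add: level_below_def)

lemma level_below_cofinal: "c < y \<Longrightarrow> \<exists>n. c \<le> level_below y n"
  using nat_approx_posE[of "y - c"] unfolding level_below_def
  by (metis diff_gt_0_iff_gt less_diff_eq less_eq_real_def max.coboundedI2 add.commute less_diff_eq)

lemma climbs_by_mono: "climbs_by p w c t \<Longrightarrow> c \<le> c' \<Longrightarrow> t \<le> t' \<Longrightarrow> climbs_by p w c' t'"
  unfolding climbs_by_def using drawdown_le_mono[OF _ order_refl, of p _ c c'] by fastforce

lemma climbs_iff_levels:
  assumes y: "0 < y"
  shows "climbs p w y \<longleftrightarrow> (\<exists>n N::nat. climbs_by p w (ereal (level_below y n)) N)"
proof
  assume "climbs p w y"
  then obtain c t where ct: "c < y" "climbs_by p w (ereal c) t"
    by (auto simp: climbs_def)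
  obtain n where n: "c \<le> level_below y n" using level_below_cofinal[OF ct(1)] by blast
  obtain N :: nat where N: "t \<le> N" using real_arch_simple by blast
  show "\<exists>n N::nat. climbs_by p w (ereal (level_below y n)) N"
    using climbs_by_mono[OF ct(2), of "ereal (level_below y n)" N] n N by auto
next
  assume "\<exists>n N::nat. climbs_by p w (ereal (level_below y n)) N"
  then obtain n N :: nat where "climbs_by p w (ereal (level_below y n)) N" by blast
  with level_below_nonneg level_below_less[OF y] show "climbs p w y"
    unfolding climbs_def by (intro exI[of _ "level_below y n"] exI[of _ "real N"]) auto
qed

lemma climbs_iff_rat:
  assumes p: "continuous_on {0..} p" and y: "0 < y"
  shows "climbs p w y \<longleftrightarrow> (\<exists>n N::nat. climbs_by_rat p w (ereal (level_below y n)) N)"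
  unfolding climbs_iff_levels[OF y]
  using climbs_by_iff_rat[OF p] level_below_nonneg by auto

text \<open>Visits of a level form a closed set of times, so the infimum in the definition of the hitting time is
attained.\<close>

lemma first_passage:
  assumes X: "continuous_on {0..} (\<lambda>t. X t \<omega>)" and H: "hitting_time X v \<omega> < top"
  obtains h where "0 \<le> h" "hitting_time X v \<omega> = ennreal h" "X h \<omega> = ereal v"
    "\<And>s. 0 \<le> s \<Longrightarrow> s < h \<Longrightarrow> X s \<omega> \<noteq> ereal v"
proof -
  let ?Z = "{t. 0 \<le> t \<and> X t \<omega> = ereal v}"
  have ne: "?Z \<noteq> {}"
    using H by (auto simp: hitting_time_def simp del: Collect_empty_eq)
  have "closed ({0..} \<inter> (\<lambda>t. X t \<omega>) -` {ereal v})"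
    by (intro continuous_closed_preimage X) auto
  moreover have "{0..} \<inter> (\<lambda>t. X t \<omega>) -` {ereal v} = ?Z" by auto
  ultimately have cl: "closed ?Z" by simp
  have bdd: "bdd_below ?Z" by (auto intro!: bdd_belowI[of _ 0])
  have h: "Inf ?Z \<in> ?Z" using closed_contains_Inf[OF ne bdd cl] .
  have lb: "Inf ?Z \<le> s" if "s \<in> ?Z" for s using cInf_lower[OF that bdd] .
  show thesis
  proof (rule that[of "Inf ?Z"])
    show "0 \<le> Inf ?Z" "X (Inf ?Z) \<omega> = ereal v" using h by auto
    show "hitting_time X v \<omega> = ennreal (Inf ?Z)"
      unfolding hitting_time_def
    proof (rule antisym)
      show "(INF t\<in>?Z. ennreal t) \<le> ennreal (Inf ?Z)" using h by (rule INF_lower)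
      show "ennreal (Inf ?Z) \<le> (INF t\<in>?Z. ennreal t)"
        by (rule INF_greatest) (auto intro!: ennreal_leI lb)
    qed
    show "X s \<omega> \<noteq> ereal v" if "0 \<le> s" "s < Inf ?Z" for s
      using lb[of s] that by auto
  qed
qed

lemma hitting_time_le: "0 \<le> t \<Longrightarrow> X t \<omega> = ereal v \<Longrightarrow> hitting_time X v \<omega> \<le> ennreal t"
  unfolding hitting_time_def by (rule INF_lower) auto

lemma hitting_time_le_iff:
  assumes X: "continuous_on {0..} (\<lambda>t. X t \<omega>)" and t: "0 \<le> t"
  shows "hitting_time X v \<omega> \<le> ennreal t \<longleftrightarrow> climbs_by (\<lambda>t. X t \<omega>) v \<infinity> t"
proof
  assume le: "hitting_time X v \<omega> \<le> ennreal t"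
  then have "hitting_time X v \<omega> < top" using ennreal_less_top le_less_trans by blast
  from first_passage[where X=X and v=v and \<omega>=\<omega>, OF X this] obtain h where
    "0 \<le> h" "hitting_time X v \<omega> = ennreal h" "X h \<omega> = ereal v" by metis
  with le t show "climbs_by (\<lambda>t. X t \<omega>) v \<infinity> t"
    by (auto simp: climbs_by_def drawdown_le_def)
next
  assume "climbs_by (\<lambda>t. X t \<omega>) v \<infinity> t"
  then obtain T where "0 \<le> T" "T \<le> t" "X T \<omega> = ereal v" by (auto simp: climbs_by_def)
  with hitting_time_le[of T X \<omega> v] show "hitting_time X v \<omega> \<le> ennreal t"
    by (meson ennreal_leI order_trans)
qed

lemma below_before_first_passage:
  fixes p :: "real \<Rightarrow> ereal"
  assumes p: "continuous_on {0..} p" and "p 0 \<le> ereal v"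
    and first: "\<And>s. 0 \<le> s \<Longrightarrow> s < h \<Longrightarrow> p s \<noteq> ereal v" and s: "0 \<le> s" "s < h"
  shows "p s < ereal v"
proof (rule ccontr)
  assume "\<not> p s < ereal v"
  then obtain r where "0 \<le> r" "r \<le> s" "p r = ereal v"
    using that IVT'[of p 0 "ereal v" s] assms(2) s continuous_on_subset[OF p, of "{0..s}"] by (auto simp: not_less)
  with first[of r] s show False by auto
qed

lemma above_before_first_passage:
  fixes p :: "real \<Rightarrow> ereal"
  assumes p: "continuous_on {0..} p" and "ereal v \<le> p 0"
    and first: "\<And>s. 0 \<le> s \<Longrightarrow> s < h \<Longrightarrow> p s \<noteq> ereal v" and s: "0 \<le> s" "s < h"
  shows "ereal v < p s"
proof (rule ccontr)
  assume "\<not> ereal v < p s"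
  then obtain r where "0 \<le> r" "r \<le> s" "p r = ereal v"
    using that IVT2'[of p s "ereal v" 0] assms(2) s continuous_on_subset[OF p, of "{0..s}"] by (auto simp: not_less)
  with first[of r] s show False by auto
qed

text \<open>The pairs of times \<open>s \<le> u \<le> T\<close> form a compact set, on which \<open>p s - p u\<close> attains its maximum. A pointwise
strict bound on the drawdowns is therefore a uniform one.\<close>

lemma climbs_strict:
  fixes p :: "real \<Rightarrow> ereal"
  assumes p: "continuous_on {0..} p" and T: "0 \<le> T" "p T = ereal w"
    and fin: "\<And>s. 0 \<le> s \<Longrightarrow> s \<le> T \<Longrightarrow> \<bar>p s\<bar> \<noteq> \<infinity>"
    and lt: "\<And>s u. 0 \<le> s \<Longrightarrow> s \<le> u \<Longrightarrow> u \<le> T \<Longrightarrow> p s < p u + ereal y"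
  shows "climbs p w y"
proof -
  define f where "f = real_of_ereal \<circ> p"
  have pf: "p s = ereal (f s)" if "0 \<le> s" "s \<le> T" for s
    using fin[OF that] by (auto simp: f_def ereal_real)
  have "continuous_on {0..T} (real_of_ereal \<circ> p)"
    using fin by (subst continuous_on_iff_real[symmetric]) 
      (auto intro: continuous_on_subset[OF p])
  then have f: "continuous_on {0..T} f" by (simp add: f_def)
  let ?K = "({0..T} \<times> {0..T}) \<inter> {z. fst z \<le> snd z}"
  have cl: "closed {z::real\<times>real. fst z \<le> snd z}"
    by (intro closed_Collect_le continuous_intros)
  have K: "compact ?K"
    by (intro compact_Int_closed compact_Times compact_Icc cl)
  have "(0, 0) \<in> ?K" using T by auto
  then have K0: "?K \<noteq> {}" by blast
  have fK: "continuous_on ?K (\<lambda>z. f (fst z) - f (snd z))"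
    by (intro continuous_intros continuous_on_compose2[OF f]) auto
  obtain z where z: "z \<in> ?K" "\<And>z'. z' \<in> ?K \<Longrightarrow> f (fst z') - f (snd z') \<le> f (fst z) - f (snd z)"
    using continuous_attains_sup[OF K K0 fK] by blast
  let ?c = "f (fst z) - f (snd z)"
  have "0 \<le> ?c" using z(2)[of "(0, 0)"] T by auto
  moreover have "?c < y"
    using lt[of "fst z" "snd z"] z(1) pf[of "fst z"] pf[of "snd z"] by (cases z) auto
  moreover have "drawdown_le p T (ereal ?c)"
    unfolding drawdown_le_def
  proof (intro allI impI)
    fix s u :: real assume su: "0 \<le> s" "s \<le> u" "u \<le> T"
    then show "p s \<le> p u + ereal ?c"
      using z(2)[of "(s, u)"] pf[of s] pf[of u] by auto
  qed
  ultimately show ?thesis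
    using climbsI T by blast
qed

text \<open>Before its first visit of \<open>v\<close> the path stays below \<open>v\<close>. A drawdown that starts before this visit and ends
after it is thus at most the drawdown measured from the visit itself, so the two parts of the path can be
judged separately.\<close>

lemma climbs_split:
  fixes p :: "real \<Rightarrow> ereal"
  assumes p: "continuous_on {0..} p" and p0: "p 0 \<le> ereal v" and vw: "v \<le> w"
    and h: "0 \<le> h" "p h = ereal v" and first: "\<And>s. 0 \<le> s \<Longrightarrow> s < h \<Longrightarrow> p s \<noteq> ereal v"
  shows "climbs p w y \<longleftrightarrow> climbs p v y \<and> climbs (\<lambda>t. p (h + t)) w y"
proof
  assume "climbs p w y"
  then obtain c T where c: "0 \<le> c" "c < y" and T: "0 \<le> T" "p T = ereal w" "drawdown_le p T (ereal c)"
    by (auto simp: climbs_def climbs_by_def)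
  have "h \<le> T"
  proof (rule ccontr)
    assume "\<not> h \<le> T"
    then have "p T < ereal v"
      by (intro below_before_first_passage[OF p p0 first]) (use T in auto)
    with T vw show False by simp
  qed
  have "drawdown_le p h (ereal c)" using drawdown_le_mono[OF T(3) \<open>h \<le> T\<close>] by blast
  moreover have "drawdown_le (\<lambda>t. p (h + t)) (T - h) (ereal c)"
    using T(3) h(1) by (auto simp: drawdown_le_def)
  ultimately show "climbs p v y \<and> climbs (\<lambda>t. p (h + t)) w y"
    using climbsI[of c y h p v] climbsI[of c y "T - h" "\<lambda>t. p (h + t)" w] c T h \<open>h \<le> T\<close> by simp
next
  assume R: "climbs p v y \<and> climbs (\<lambda>t. p (h + t)) w y"
  obtain c T where c: "0 \<le> c" "c < y" and T: "0 \<le> T" "p T = ereal v" "drawdown_le p T (ereal c)"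
    using R by (auto simp: climbs_def climbs_by_def)
  obtain d U where d: "0 \<le> d" "d < y" and U: "0 \<le> U" "p (h + U) = ereal w"
    "drawdown_le (\<lambda>t. p (h + t)) U (ereal d)"
    using R by (auto simp: climbs_def climbs_by_def)
  have "h \<le> T" using first[of T] T by force
  \<comment> \<open>Both parts of the path leave a gap below \<open>y\<close>; the larger bound serves for the whole.\<close>
  define e where "e = max c d"
  have le_v: "p s \<le> ereal v" if "0 \<le> s" "s \<le> h" for s
    using below_before_first_passage[OF p p0 first that(1)] that h(2)
    by (cases "s = h") (auto intro: less_imp_le)
  have "drawdown_le p (h + U) (ereal e)"
    unfolding drawdown_le_def
  proof (intro allI impI)
    fix s u :: real assume su: "0 \<le> s" "s \<le> u" "u \<le> h + U"
    have after: "p (h + a) \<le> p (h + b) + ereal e" if "0 \<le> a" "a \<le> b" "b \<le> U" for a b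
      using drawdown_le_mono[OF U(3) order_refl, of "ereal e"] that
      by (auto simp: e_def drawdown_le_def)
    show "p s \<le> p u + ereal e"
    proof (cases "u \<le> h")
      case True
      then show ?thesis
        using drawdown_le_mono[OF T(3) \<open>h \<le> T\<close>, of "ereal e"] su by (auto simp: e_def drawdown_le_def)
    next
      case False
      show ?thesis
      proof (cases "h \<le> s")
        case True
        then show ?thesis using after[of "s - h" "u - h"] su by auto
      next
        case s: False
        then show ?thesis
          using after[of 0 "u - h"] le_v[of s] su h False by auto
      qed
    qed
  qed
  then show "climbs p w y"
    using climbsI[of e y "h + U" p w] c d U h by (simp add: e_def)
qed

text \<open>Finiteness on \<open>[0, h]\<close> is what makes the difference between the running maximum and the path meaningful;
in the extended reals \<open>\<infinity> - \<infinity> = \<infinity>\<close>.\<close>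

lemma max_drawdown_less_iff:
  assumes X: "continuous_on {0..} (\<lambda>t. X t \<omega>)"
    and h: "0 \<le> h" "X h \<omega> = ereal w" and first: "\<And>s. 0 \<le> s \<Longrightarrow> s < h \<Longrightarrow> X s \<omega> \<noteq> ereal w"
    and fin: "\<And>s. 0 \<le> s \<Longrightarrow> s \<le> h \<Longrightarrow> \<bar>X s \<omega>\<bar> \<noteq> \<infinity>"
  shows "max_drawdown X h \<omega> < ereal y \<longleftrightarrow> climbs (\<lambda>t. X t \<omega>) w y"
proof
  assume lt: "max_drawdown X h \<omega> < ereal y"
  have le: "running_max X u \<omega> - X u \<omega> \<le> max_drawdown X h \<omega>" if "0 \<le> u" "u \<le> h" for u
    unfolding max_drawdown_def by (rule SUP_upper) (use that in auto)
  have step: "X s \<omega> \<le> X u \<omega> + max_drawdown X h \<omega>" if "0 \<le> s" "s \<le> u" "u \<le> h" for s u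
  proof -
    have "X s \<omega> \<le> running_max X u \<omega>"
      unfolding running_max_def by (rule SUP_upper) (use that in auto)
    then have "X s \<omega> - X u \<omega> \<le> max_drawdown X h \<omega>"
      using le[of u] that by (meson ereal_minus_mono order_refl order_trans)
    then show ?thesis
      using fin[of u] that by (auto simp: ereal_minus_le add.commute)
  qed
  have "0 \<le> max_drawdown X h \<omega>"
    using step[of h h] h fin[of h] by (cases "max_drawdown X h \<omega>") (auto)
  with lt obtain c where c: "max_drawdown X h \<omega> = ereal c" "0 \<le> c" "c < y"
    by (cases "max_drawdown X h \<omega>") auto
  show "climbs (\<lambda>t. X t \<omega>) w y"
    by (rule climbsI[of c y h]) (use c step h in \<open>auto simp: drawdown_le_def\<close>)
next
  assume "climbs (\<lambda>t. X t \<omega>) w y"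
  then obtain c T where c: "0 \<le> c" "c < y" and T: "0 \<le> T" "X T \<omega> = ereal w"
    "drawdown_le (\<lambda>t. X t \<omega>) T (ereal c)"
    by (auto simp: climbs_def climbs_by_def)
  have "h \<le> T" using first[of T] T by force
  have "max_drawdown X h \<omega> \<le> ereal c"
    unfolding max_drawdown_def
  proof (rule SUP_least)
    fix u assume u: "u \<in> {0..h}"
    have "running_max X u \<omega> \<le> X u \<omega> + ereal c"
      unfolding running_max_def
      by (rule SUP_least) (use u T(3) \<open>h \<le> T\<close> in \<open>auto simp: drawdown_le_def\<close>)
    then show "running_max X u \<omega> - X u \<omega> \<le> ereal c"
      using fin[of u] u by (auto simp: ereal_minus_le add.commute)
  qed
  with c show "max_drawdown X h \<omega> < ereal y"
    by (meson ereal_less_eq(3) less_ereal.simps(1) order_le_less_trans)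
qed

section \<open>From increments to the exponential formula\<close>

text \<open>The quotients \<open>(h w - h z) / (w - z)\<close> for \<open>w < z\<close> and for \<open>w > z\<close> are treated at once, in terms of the
smaller and the larger of the two points. They are squeezed to \<open>- h z * f z\<close>, where \<open>f\<close> is the integrand, so that \<open>h * exp A\<close> is constant for the antiderivative \<open>A\<close> of
\<open>f\<close>. Multiplying by the exponential, rather than taking the logarithm of \<open>h\<close>, avoids a separate proof that
\<open>h\<close> is positive.\<close>

lemma exp_decay_from_increments:
  fixes G :: "real \<Rightarrow> real \<Rightarrow> real" and S S' :: "real \<Rightarrow> real" and y a b :: real
  assumes ab: "a \<le> b" and y: "0 < y"
    and S': "\<And>z. z \<in> {a..b} \<Longrightarrow> (S has_real_derivative S' z) (at z)"
    and contS': "continuous_on {a..b} S'"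
    and contS: "continuous_on {a - y..b} S"
    and mono: "strict_mono_on {a - y..b} S"
    and start: "G a a = 1"
    and nonneg: "\<And>z w. 0 \<le> G z w" and le1: "\<And>z w. a \<le> z \<Longrightarrow> G z w \<le> 1"
    and mult: "\<And>z w. a \<le> z \<Longrightarrow> z \<le> w \<Longrightarrow> w \<le> b \<Longrightarrow> G a w = G a z * G z w"
    and lower: "\<And>z w. a \<le> z \<Longrightarrow> z < w \<Longrightarrow> w \<le> b \<Longrightarrow> w < z + y \<Longrightarrow>
      1 - (S w - S z) / (S w - S (w - y)) \<le> G z w"
    and upper: "\<And>z w. a \<le> z \<Longrightarrow> z < w \<Longrightarrow> w \<le> b \<Longrightarrow> 
      G z w \<le> 1 - (S w - S z) / (S w - S (z - y))"
  shows "G a b = exp (- integral {a..b} (\<lambda>z. S' z / (S z - S (z - y))))"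
proof -
  define f where "f z = S' z / (S z - S (z - y))" for z
  define h where "h w = G a w" for w
  have less: "S u < S v" if "a - y \<le> u" "u < v" "v \<le> b" for u v
    using mono that by (auto simp: strict_mono_on_def)
  have cS: "continuous_on {a..b} S"
    using y by (intro continuous_on_subset[OF contS]) auto
  have cSy: "continuous_on {a..b} (\<lambda>z. S (z - y))"
    using y by (intro continuous_on_compose2[OF contS] continuous_intros) auto
  have f: "continuous_on {a..b} f"
    unfolding f_def
    by (intro continuous_intros contS' cS cSy ballI) (use less[of "_ - y" "_"] y in force)
  have deriv: "(h has_real_derivative - h z * f z) (at z within {a..b})" if z: "z \<in> {a..b}" for z
  proof -
    let ?F = "at z within {a..b}"
    \<comment> \<open>The increments between \<open>w\<close> and \<open>z\<close>, irrespective of their order, are \<open>G (lo w) (hi w)\<close>.\<close>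
    define lo where "lo w = min w z" for w
    define hi where "hi w = max w z" for w
    have in_ev: "\<forall>\<^sub>F w in ?F. w \<in> {a..b}"
      by (auto simp: eventually_at_filter)
    have lohi: "\<forall>\<^sub>F w in ?F. lo w \<in> {a..b}" "\<forall>\<^sub>F w in ?F. hi w \<in> {a..b}"
      using in_ev by (eventually_elim; use z in \<open>auto simp: lo_def hi_def\<close>)+
    have id: "((\<lambda>w. w) \<longlongrightarrow> z) ?F" by (rule tendsto_ident_at)
    have lo: "(lo \<longlongrightarrow> z) ?F" and hi: "(hi \<longlongrightarrow> z) ?F"
      unfolding lo_def hi_def using tendsto_min[OF id tendsto_const, of z] tendsto_max[OF id tendsto_const, of z] by simp_all
    note lim = continuous_on_tendsto_compose[OF _ lo z lohi(1)] continuous_on_tendsto_compose[OF _ hi z lohi(2)]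
    have Shi: "((\<lambda>w. S (hi w)) \<longlongrightarrow> S z) ?F" by (rule lim(2)[OF cS])
    have Slo: "((\<lambda>w. S (lo w)) \<longlongrightarrow> S z) ?F" by (rule lim(1)[OF cS])
    have Shiy: "((\<lambda>w. S (hi w - y)) \<longlongrightarrow> S (z - y)) ?F" by (rule lim(2)[OF cSy])
    have Sloy: "((\<lambda>w. S (lo w - y)) \<longlongrightarrow> S (z - y)) ?F" by (rule lim(1)[OF cSy])
    have gap: "S z - S (z - y) \<noteq> 0" using less[of "z - y" z] z y by auto
    have near: "\<forall>\<^sub>F w in ?F. w \<in> {a..b} \<and> w \<noteq> z \<and> dist w z < y"
      unfolding eventually_at using y by (intro exI[of _ y]) auto
    define r where "r w = (S (hi w) - S (lo w)) / (S (hi w) - S (hi w - y))" for w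
    define t where "t w = (S (hi w) - S (lo w)) / (S (hi w) - S (lo w - y))" for w
    have G: "1 - r w \<le> G (lo w) (hi w)" "G (lo w) (hi w) \<le> 1 - t w" "h (hi w) = h (lo w) * G (lo w) (hi w)"
       "G (lo w) (hi w) \<le> 1" if "w \<in> {a..b} \<and> w \<noteq> z \<and> dist w z < y" for w
    proof -
      have b: "a \<le> lo w" "lo w < hi w" "hi w \<le> b" "hi w < lo w + y"
        using that z by (auto simp: lo_def hi_def dist_real_def)
      show "1 - r w \<le> G (lo w) (hi w)" unfolding r_def by (rule lower[OF b])
      show "G (lo w) (hi w) \<le> 1 - t w" unfolding t_def by (rule upper[OF b(1-3)])
      show "h (hi w) = h (lo w) * G (lo w) (hi w)"
        unfolding h_def by (rule mult[OF b(1) less_imp_le[OF b(2)] b(3)])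
      show "G (lo w) (hi w) \<le> 1" by (rule le1[OF b(1)])
    qed
    have h01: "0 \<le> h w" "h w \<le> 1" for w using nonneg le1 by (auto simp: h_def)
    have r0: "(r \<longlongrightarrow> 0) ?F"
      unfolding r_def using tendsto_divide[OF tendsto_diff[OF Shi Slo] tendsto_diff[OF Shi Shiy] gap] by simp
    have hlo: "((\<lambda>w. h (lo w)) \<longlongrightarrow> h z) ?F"
    proof -
      have "((\<lambda>w. h (lo w) - h z) \<longlongrightarrow> 0) ?F"
      proof (rule Lim_null_comparison[OF _ r0])
        show "\<forall>\<^sub>F w in ?F. norm (h (lo w) - h z) \<le> r w"
          using near
        proof eventually_elim
          case (elim w)
          show ?case
          proof (cases "w < z")
            case True
            have "h (lo w) - h (hi w) = h (lo w) * (1 - G (lo w) (hi w))"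
              using G(3)[OF elim] by (simp add: algebra_simps)
            moreover have "\<dots> \<le> 1 * r w"
              using G(1,4)[OF elim] h01[of "lo w"] by (intro mult_mono) auto
            moreover have "0 \<le> h (lo w) * (1 - G (lo w) (hi w))" using h01[of "lo w"] G(4)[OF elim] by simp
            ultimately have "\<bar>h (lo w) - h (hi w)\<bar> \<le> r w" by simp
            then show ?thesis using True by (simp add: hi_def)
          next
            case False
            then have "lo w = z" by (simp add: lo_def)
            moreover have "0 \<le> r w" using G(1,4)[OF elim] by simp
            ultimately show ?thesis by simp
          qed
        qed
      qed
      then show ?thesis by (simp add: LIM_zero_iff)
    qed
    have slope: "((\<lambda>w. (S w - S z) / (w - z)) \<longlongrightarrow> S' z) ?F"
      using has_field_derivative_at_within[OF S'[OF z], of "{a..b}"] by (simp add: has_field_derivative_iff)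
    have quot_eq: "(k w - k z) / (w - z) = (k (hi w) - k (lo w)) / (hi w - lo w)"
      for w and k :: "real \<Rightarrow> real"
    proof (cases "w < z")
      case True
      then show ?thesis
        using minus_divide_divide[of "k w - k z" "w - z"] by (simp add: hi_def lo_def)
    qed (simp add: hi_def lo_def)
    have q: "h (lo w) * - ((S w - S z) / (w - z) / (S (hi w) - S (hi w - y))) \<le> (h w - h z) / (w - z)"
       "(h w - h z) / (w - z) \<le> h (lo w) * - ((S w - S z) / (w - z) / (S (hi w) - S (lo w - y)))"
      if w: "w \<in> {a..b} \<and> w \<noteq> z \<and> dist w z < y" for w
    proof -
      have d: "0 < hi w - lo w" using w by (auto simp: hi_def lo_def)
      have eq: "(h w - h z) / (w - z) = h (lo w) * ((G (lo w) (hi w) - 1) / (hi w - lo w))"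
        unfolding quot_eq[of h w] G(3)[OF w] by (simp add: algebra_simps)
      have r_eq: "(S w - S z) / (w - z) / (S (hi w) - S (hi w - y)) = r w / (hi w - lo w)"
        and t_eq: "(S w - S z) / (w - z) / (S (hi w) - S (lo w - y)) = t w / (hi w - lo w)"
        unfolding r_def t_def quot_eq[of S w] by (simp_all add: mult.commute)
      have "- r w / (hi w - lo w) \<le> (G (lo w) (hi w) - 1) / (hi w - lo w)"
        "(G (lo w) (hi w) - 1) / (hi w - lo w) \<le> - t w / (hi w - lo w)"
        using G(1,2)[OF w] d by (intro divide_right_mono; simp)+
      from this[THEN mult_left_mono, OF h01(1)[of "lo w"]]
      show "h (lo w) * - ((S w - S z) / (w - z) / (S (hi w) - S (hi w - y))) \<le> (h w - h z) / (w - z)"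
        "(h w - h z) / (w - z) \<le> h (lo w) * - ((S w - S z) / (w - z) / (S (hi w) - S (lo w - y)))"
        unfolding eq r_eq t_eq minus_divide_left .
    qed
    have "((\<lambda>w. (h w - h z) / (w - z)) \<longlongrightarrow> h z * - (S' z / (S z - S (z - y)))) ?F"
    proof (rule tendsto_sandwich)
      show "((\<lambda>w. h (lo w) * - ((S w - S z) / (w - z) / (S (hi w) - S (hi w - y)))) \<longlongrightarrow>
          h z * - (S' z / (S z - S (z - y)))) ?F"
        by (intro tendsto_intros hlo slope Shi Shiy gap)
      show "((\<lambda>w. h (lo w) * - ((S w - S z) / (w - z) / (S (hi w) - S (lo w - y)))) \<longlongrightarrow>
          h z * - (S' z / (S z - S (z - y)))) ?F"
        by (intro tendsto_intros hlo slope Shi Sloy gap)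
    qed (use near q in \<open>auto elim: eventually_mono\<close>)
    then show ?thesis by (simp add: has_field_derivative_iff f_def)
  qed
  define A where "A w = integral {a..w} f" for w
  have A: "(A has_real_derivative f z) (at z within {a..b})" if "z \<in> {a..b}" for z
    unfolding A_def using integral_has_real_derivative[OF f that] .
  have "((\<lambda>w. h w * exp (A w)) has_real_derivative 0) (at z within {a..b})" if "z \<in> {a..b}" for z
    by (rule derivative_eq_intros deriv A that refl)+ (simp add: algebra_simps)
  then obtain k where "\<And>z. z \<in> {a..b} \<Longrightarrow> h z * exp (A z) = k"
    using has_field_derivative_zero_constant[of "{a..b}" "\<lambda>w. h w * exp (A w)"] by auto
  then have "h b * exp (A b) = h a * exp (A a)" using ab by auto
  also have "\<dots> = 1" by (simp add: h_def A_def start)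
  finally have "h b = exp (- A b)" by (simp add: exp_minus field_simps)
  then show ?thesis by (simp add: h_def A_def f_def[abs_def])
qed

lemma exp_neg_limit:
  assumes A: "\<And>n. 0 \<le> A n" and U: "(\<lambda>n. ennreal (A n)) \<longlonglongrightarrow> U"
  shows "(\<lambda>n. exp (- A n)) \<longlonglongrightarrow> exp_neg U"
proof (cases U)
  case (real u)
  have "A \<longlonglongrightarrow> u"
    using U real A by (simp add: tendsto_ennreal_iff)
  then have "(\<lambda>n. exp (- A n)) \<longlonglongrightarrow> exp (- u)" by (intro tendsto_intros)
  with real show ?thesis by (simp add: exp_neg_def)
next
  case top
  have "filterlim A at_top sequentially"
    unfolding filterlim_at_top
  proof
    fix Z
    have "\<forall>\<^sub>F n in sequentially. ennreal Z < ennreal (A n)"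
      using U top by (intro order_tendstoD) auto
    then show "\<forall>\<^sub>F n in sequentially. Z \<le> A n"
    proof eventually_elim
      case (elim n)
      then show ?case using A[of n] by (cases "0 \<le> Z") (auto simp: ennreal_less_iff)
    qed
  qed
  then have "(\<lambda>n. exp (- A n)) \<longlonglongrightarrow> 0"
    by (intro filterlim_compose[OF exp_at_bot] filterlim_compose[OF filterlim_uminus_at_bot_at_top])
  with top show ?thesis by (simp add: exp_neg_def)
qed

text \<open>The integrand may be unbounded near \<open>c\<close>, and the integral over the half-open interval may be infinite; the
convergence is monotone.\<close>

lemma integral_left_limit:
  fixes f :: "real \<Rightarrow> real"
  assumes cb: "c < b" and f: "continuous_on {c<..b} f" and nn: "\<And>z. z \<in> {c<..b} \<Longrightarrow> 0 \<le> f z"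
  shows "(\<lambda>n. ennreal (integral {c + (b - c) / Suc n..b} f)) \<longlonglongrightarrow>
    (\<integral>\<^sup>+z. ennreal (f z) * indicator {c<..b} z \<partial>lborel)"
proof -
  define w where "w n = c + (b - c) / Suc n" for n :: nat
  have w: "c < w n" "w n \<le> b" for n
    using cb divide_left_mono[of 1 "real (Suc n)" "b - c"] by (simp_all add: w_def)
  have sub: "{w n..b} \<subseteq> {c<..b}" for n using w[of n] by auto
  have dec: "w n \<le> w m" if "m \<le> n" for m n
    using cb that by (auto simp: w_def intro!: divide_left_mono)
  have eq: "(\<integral>\<^sup>+z. ennreal (f z) * indicator {w n..b} z \<partial>lborel) = ennreal (integral {w n..b} f)" for n
    using sub[of n] nn
    by (intro nn_integral_has_integral_lebesgue' integrable_integral integrable_continuous_real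
        continuous_on_subset[OF f]) auto
  have "(\<lambda>n. \<integral>\<^sup>+z. ennreal (f z) * indicator {w n..b} z \<partial>lborel) \<longlonglongrightarrow>
    (\<integral>\<^sup>+z. ennreal (f z) * indicator {c<..b} z \<partial>lborel)"
  proof (rule nn_integral_LIMSEQ)
    show "incseq (\<lambda>n z. ennreal (f z) * indicator {w n..b} z)"
    proof (intro incseq_SucI le_funI mult_left_mono)
      show "indicator {w n..b} z \<le> (indicator {w (Suc n)..b} z :: ennreal)" for n z
        using dec[of n "Suc n"] by (auto split: split_indicator)
    qed simp
    show "(\<lambda>z. ennreal (f z) * indicator {w n..b} z) \<in> borel_measurable lborel" for n
    proof -
      have "(\<lambda>z. indicator {w n..b} z *\<^sub>R f z) \<in> borel_measurable borel"
        by (intro borel_measurable_continuous_on_indicator continuous_on_subset[OF f sub]) auto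
      then have "(\<lambda>z. ennreal (indicator {w n..b} z *\<^sub>R f z)) \<in> borel_measurable lborel" by simp
      also have "(\<lambda>z. ennreal (indicator {w n..b} z *\<^sub>R f z)) = (\<lambda>z. ennreal (f z) * indicator {w n..b} z)"
        by (auto split: split_indicator)
      finally show ?thesis .
    qed
    show "(\<lambda>n. ennreal (f z) * indicator {w n..b} z) \<longlonglongrightarrow> ennreal (f z) * indicator {c<..b} z" for z
    proof (cases "c < z")
      case True
      have "w \<longlonglongrightarrow> c + 0"
        unfolding w_def by (intro tendsto_intros LIMSEQ_Suc[OF lim_const_over_n])
      then have "\<forall>\<^sub>F n in sequentially. w n < z" using True by (intro order_tendstoD) auto
      then have "\<forall>\<^sub>F n in sequentially. ennreal (f z) * indicator {w n..b} z = ennreal (f z) * indicator {c<..b} z"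
        by eventually_elim (use True in \<open>auto split: split_indicator\<close>)
      then show ?thesis by (rule tendsto_eventually)
    next
      case False
      then have "ennreal (f z) * indicator {w n..b} z = ennreal (f z) * indicator {c<..b} z" for n
        using w[of n] by (auto split: split_indicator)
      then show ?thesis by simp
    qed
  qed
  then have "(\<lambda>n. ennreal (integral {w n..b} f)) \<longlonglongrightarrow> (\<integral>\<^sup>+z. ennreal (f z) * indicator {c<..b} z \<partial>lborel)"
    unfolding eq .
  then show ?thesis unfolding w_def .
qed


lemma C1_deriv:
  assumes "S C1_differentiable_on U" "z \<in> U"
  shows "(S has_real_derivative deriv S z) (at z)"
proof -
  obtain D where "(S has_vector_derivative D z) (at z)"
    using assms unfolding C1_differentiable_on_def by blast
  then have "(S has_real_derivative D z) (at z)"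
    by (simp add: has_real_derivative_iff_has_vector_derivative)
  then show ?thesis using DERIV_imp_deriv by fastforce
qed

lemma C1_deriv_continuous:
  fixes S :: "real \<Rightarrow> real"
  assumes "S C1_differentiable_on U"
  shows "continuous_on U (deriv S)"
proof -
  obtain D where D: "\<And>z. z \<in> U \<Longrightarrow> (S has_vector_derivative D z) (at z)" and c: "continuous_on U D"
    using assms unfolding C1_differentiable_on_def by blast
  have "deriv S z = D z" if "z \<in> U" for z
    using D[OF that] by (intro DERIV_imp_deriv) (simp add: has_real_derivative_iff_has_vector_derivative)
  with c show ?thesis by (simp cong: continuous_on_cong)
qed

lemma C1_mono_deriv_nonneg:
  fixes S :: "real \<Rightarrow> real"
  assumes C1: "S C1_differentiable_on interior I" and mono: "strict_mono_on (interior I) S"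
    and z: "z \<in> interior I"
  shows "0 \<le> deriv S z"
  using z C1_deriv[OF C1 z] strict_mono_on_imp_mono_on[OF mono]
  by (intro mono_on_imp_deriv_nonneg[of "interior I" S]) auto

lemma C1_density_measurable:
  fixes S :: "real \<Rightarrow> real"
  assumes C1: "S C1_differentiable_on interior I"
  shows "(\<lambda>z. ennreal (deriv S z) * indicator (interior I) z) \<in> borel_measurable lborel"
proof -
  have "(\<lambda>z. indicator (interior I) z *\<^sub>R deriv S z) \<in> borel_measurable borel"
    by (intro borel_measurable_continuous_on_indicator C1_deriv_continuous C1) auto
  then have "(\<lambda>z. ennreal (indicator (interior I) z *\<^sub>R deriv S z)) \<in> borel_measurable lborel" by simp
  also have "(\<lambda>z. ennreal (indicator (interior I) z *\<^sub>R deriv S z)) =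
      (\<lambda>z. ennreal (deriv S z) * indicator (interior I) z)" by (auto split: split_indicator)
  finally show ?thesis .
qed

text \<open>The point \<open>c\<close> itself may be such that \<open>c - y\<close> is an endpoint of \<open>I\<close>, where \<open>S\<close> has no meaning. It is a null
set for the measure \<open>S(dz)\<close>.\<close>

lemma stieltjes_integral_eq:
  fixes S :: "real \<Rightarrow> real"
  assumes C1: "S C1_differentiable_on interior I" and mono: "strict_mono_on (interior I) S"
    and y: "0 < y" and sub: "\<And>z. c < z \<Longrightarrow> z \<le> b \<Longrightarrow> z \<in> interior I \<and> z - y \<in> interior I"
  shows "(\<integral>\<^sup>+z\<in>{c..b}. 1 / ennreal (S z - S (z - y)) \<partial>scale_stieltjes I S) =
    (\<integral>\<^sup>+z. ennreal (deriv S z / (S z - S (z - y))) * indicator {c<..b} z \<partial>lborel)"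
proof -
  let ?U = "interior I"
  let ?g = "\<lambda>z. ennreal (deriv S z) * indicator ?U z"
  let ?\<phi> = "\<lambda>z. ennreal (indicator {c<..b} z *\<^sub>R (1 / (S z - S (z - y))))"
  have cS: "continuous_on ?U S"
    using C1_deriv[OF C1] by (intro DERIV_continuous_on) (auto intro: has_field_derivative_at_within)
  have gap: "S (z - y) < S z" if "c < z" "z \<le> b" for z
    using mono sub[OF that] y by (auto simp: strict_mono_on_def)
  note dnn = C1_mono_deriv_nonneg[OF C1 mono]
  note g = C1_density_measurable[OF C1]
  have "continuous_on {c<..b} (\<lambda>z. 1 / (S z - S (z - y)))"
    using sub gap
    by (intro continuous_intros continuous_on_compose2[OF cS]) force+
  then have "(\<lambda>z. indicator {c<..b} z *\<^sub>R (1 / (S z - S (z - y)))) \<in> borel_measurable borel"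
    by (intro borel_measurable_continuous_on_indicator) auto
  then have \<phi>: "?\<phi> \<in> borel_measurable lborel" by simp
  have "(\<integral>\<^sup>+z\<in>{c..b}. 1 / ennreal (S z - S (z - y)) \<partial>scale_stieltjes I S) = (\<integral>\<^sup>+z. ?\<phi> z \<partial>scale_stieltjes I S)"
  proof (rule nn_integral_cong_AE)
    have "AE z in scale_stieltjes I S. z \<noteq> c"
      unfolding scale_stieltjes_def
      by (subst AE_density[OF g]) (use AE_lborel_singleton[of c] in eventually_elim, auto)
    then show "AE z in scale_stieltjes I S. 1 / ennreal (S z - S (z - y)) * indicator {c..b} z = ?\<phi> z"
    proof eventually_elim
      case (elim z)
      show ?case
      proof (cases "z \<in> {c<..b}")
        case True
        then have "1 / ennreal (S z - S (z - y)) = ennreal (1 / (S z - S (z - y)))"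
          using gap[of z] divide_ennreal[of 1 "S z - S (z - y)"] by simp
        with True show ?thesis by simp
      qed (use elim in auto)
    qed
  qed
  also have "\<dots> = (\<integral>\<^sup>+z. ?g z * ?\<phi> z \<partial>lborel)"
    unfolding scale_stieltjes_def by (rule nn_integral_density[OF g \<phi>])
  also have "\<dots> = (\<integral>\<^sup>+z. ennreal (deriv S z / (S z - S (z - y))) * indicator {c<..b} z \<partial>lborel)"
  proof (rule nn_integral_cong)
    fix z
    show "?g z * ?\<phi> z = ennreal (deriv S z / (S z - S (z - y))) * indicator {c<..b} z"
      using sub[of z] dnn[of z] gap[of z]
      by (cases "z \<in> {c<..b}") (auto simp: ennreal_mult'[symmetric])
  qed
  finally show ?thesis .
qed

text \<open>For \<open>y = 0\<close> the integrand is \<open>1 / 0 = \<infinity>\<close> everywhere, and \<open>S(dz)\<close> charges every nondegenerate interval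
because \<open>S\<close> is strictly increasing.\<close>

lemma stieltjes_integral_diverges:
  fixes S :: "real \<Rightarrow> real"
  assumes C1: "S C1_differentiable_on interior I" and mono: "strict_mono_on (interior I) S"
    and cb: "c < b" and sub: "{c<..b} \<subseteq> interior I"
  shows "(\<integral>\<^sup>+z\<in>{c..b}. 1 / ennreal (S z - S z) \<partial>scale_stieltjes I S) = top"
proof -
  let ?U = "interior I"
  let ?g = "\<lambda>z. ennreal (deriv S z) * indicator ?U z"
  note dnn = C1_mono_deriv_nonneg[OF C1 mono]
  note g = C1_density_measurable[OF C1]
  define d where "d = (c + b) / 2"
  have d: "c < d" "d < b" using cb by (auto simp: d_def)
  have dU: "{d..b} \<subseteq> ?U" using sub d by auto
  have "S d < S b" using mono d subsetD[OF dU, of d] subsetD[OF dU, of b] by (auto simp: strict_mono_on_def)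
  have "(\<integral>\<^sup>+z. ennreal (deriv S z) * indicator {d..b} z \<partial>lborel) = ennreal (S b - S d)"
  proof (rule nn_integral_has_integral_lebesgue')
    show "(deriv S has_integral S b - S d) {d..b}"
    proof (rule fundamental_theorem_of_calculus)
      fix z assume "z \<in> {d..b}"
      then have "(S has_real_derivative deriv S z) (at z within {d..b})"
        using C1_deriv[OF C1] dU has_field_derivative_at_within by blast
      then show "(S has_vector_derivative deriv S z) (at z within {d..b})"
        by (simp add: has_real_derivative_iff_has_vector_derivative)
    qed (use d in simp)
  qed (use dnn dU in auto)
  also have "\<dots> > 0" using \<open>S d < S b\<close> by simp
  finally have pos: "0 < (\<integral>\<^sup>+z. ennreal (deriv S z) * indicator {d..b} z \<partial>lborel)" .
  have "(\<integral>\<^sup>+z. ennreal (deriv S z) * indicator {d..b} z \<partial>lborel) \<le> (\<integral>\<^sup>+z. ?g z * indicator {c..b} z \<partial>lborel)"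
    using dU d by (intro nn_integral_mono) (auto split: split_indicator)
  also have "\<dots> = emeasure (scale_stieltjes I S) {c..b}"
    unfolding scale_stieltjes_def using g by (subst emeasure_density) auto
  finally have "0 < emeasure (scale_stieltjes I S) {c..b}" using pos by (rule order.strict_trans2[rotated])
  moreover have "(\<integral>\<^sup>+z\<in>{c..b}. 1 / ennreal (S z - S z) \<partial>scale_stieltjes I S) =
      top * emeasure (scale_stieltjes I S) {c..b}"
  proof -
    have "(1::ennreal) / 0 = top" by (simp add: ennreal_divide_zero)
    moreover have "{c..b} \<in> sets (scale_stieltjes I S)" by (simp add: scale_stieltjes_def)
    ultimately show ?thesis by (simp add: nn_integral_cmult_indicator)
  qed
  ultimately show ?thesis by (simp add: ennreal_top_mult)
qed

context ito_mckean_diffusion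
begin

section \<open>Climb events, first passage and the strong Markov property\<close>

lemma prob_P: "x \<in> I \<Longrightarrow> prob_space (P x)"
  using measurable_space[OF kernel, of x] by (simp add: space_restrict_space space_prob_algebra)

lemma sets_P: "x \<in> I \<Longrightarrow> sets (P x) = sets M"
  using measurable_space[OF kernel, of x] by (simp add: space_restrict_space space_prob_algebra)

lemma space_P: "x \<in> I \<Longrightarrow> space (P x) = space M"
  using sets_P sets_eq_imp_space_eq by blast

lemma X_measurable_F: "0 \<le> q \<Longrightarrow> ennreal q \<le> t \<Longrightarrow> X q \<in> borel_measurable (F t)"
  using adapted[of q] sets_F_mono[of "ennreal q" t] space_F
  by (auto simp: measurable_def) 

lemma X_measurable: "0 \<le> q \<Longrightarrow> X q \<in> borel_measurable M"
  using measurable_from_subalg[OF filtration_sub adapted] by blast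

lemma sets_F_le: "A \<in> sets (F t) \<Longrightarrow> A \<in> sets M"
  using filtration_sub[of t] by (auto simp: subalgebra_def)

lemma climbs_by_F:
  assumes "0 \<le> c" "0 \<le> t"
  shows "{\<omega>\<in>space M. climbs_by (\<lambda>t. X t \<omega>) w c t} \<in> sets (F (ennreal t))"
proof -
  have "{\<omega>\<in>space (F (ennreal t)). climbs_by_rat (\<lambda>t. X t \<omega>) w c t} \<in> sets (F (ennreal t))"
    by (intro climbs_by_rat_sets X_measurable_F ennreal_leI)
  moreover have "{\<omega>\<in>space (F (ennreal t)). climbs_by_rat (\<lambda>t. X t \<omega>) w c t} =
      {\<omega>\<in>space M. climbs_by (\<lambda>t. X t \<omega>) w c t}"
    using climbs_by_iff_rat[OF continuous_paths assms] by (auto simp: space_F)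
  ultimately show ?thesis by simp
qed

definition climb_event :: "real \<Rightarrow> real \<Rightarrow> 'w set" where
  "climb_event w y = {\<omega>\<in>space M. climbs (\<lambda>t. X t \<omega>) w y}"

lemma stopping_time_hitting: "stopping_time F (hitting_time X v)"
proof
  fix t :: ennreal
  show "Measurable.pred (F t) (\<lambda>\<omega>. hitting_time X v \<omega> \<le> t)"
  proof (cases t)
    case (real r)
    have "{\<omega>\<in>space M. climbs_by (\<lambda>t. X t \<omega>) v \<infinity> r} \<in> sets (F t)"
      using climbs_by_F[of \<infinity> r v] real by simp
    moreover have "{\<omega>\<in>space M. climbs_by (\<lambda>t. X t \<omega>) v \<infinity> r} = {\<omega>\<in>space (F t). hitting_time X v \<omega> \<le> t}"
      using hitting_time_le_iff[where X=X, OF continuous_paths] real by (auto simp: space_F)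
    ultimately show ?thesis by (simp add: pred_def)
  next
    case top
    then show ?thesis by simp
  qed
qed

lemma hitting_time_measurable: "hitting_time X v \<in> borel_measurable M"
  by (rule measurable_stopping_time[OF stopping_time_hitting]) (auto simp: space_F sets_F_le)

lemma crosses_level:
  assumes "\<omega> \<in> space M" "X 0 \<omega> \<le> ereal v" "ereal v \<le> X T \<omega>" "0 \<le> T"
  obtains s where "0 \<le> s" "s \<le> T" "X s \<omega> = ereal v"
  using IVT'[of "\<lambda>t. X t \<omega>" 0 "ereal v" T, OF assms(2,3,4)]
    continuous_on_subset[OF continuous_paths[OF assms(1)], of "{0..T}"] atLeastatMost_subset_iff
  by (metis atLeastAtMost_iff atLeast_iff subsetI)

lemma climbs_hit:
  assumes "\<omega> \<in> space M" "climbs (\<lambda>t. X t \<omega>) v y"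
  shows "hitting_time X v \<omega> < top"
proof -
  obtain T where "0 \<le> T" "X T \<omega> = ereal v" using assms(2) by (auto simp: climbs_def climbs_by_def)
  then have "hitting_time X v \<omega> \<le> ennreal T" by (rule hitting_time_le)
  then show ?thesis using ennreal_less_top le_less_trans by blast
qed

text \<open>On the event that \<open>v\<close> is hit by time \<open>t\<close>, the drawdown condition concerns the path up to time \<open>t\<close> only. This
puts the climb event into the \<open>\<sigma>\<close>-algebra at the hitting time.\<close>

lemma climbs_and_hit_by_iff_levels:
  assumes "0 < y" "\<omega> \<in> space M" "0 \<le> t"
  shows "climbs (\<lambda>t. X t \<omega>) v y \<and> hitting_time X v \<omega> \<le> ennreal t \<longleftrightarrow>
    (\<exists>n::nat. climbs_by (\<lambda>t. X t \<omega>) v (ereal (level_below y n)) t)" (is "?L \<longleftrightarrow> ?R")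
proof
  assume L: ?L
  obtain h where h: "0 \<le> h" "hitting_time X v \<omega> = ennreal h" "X h \<omega> = ereal v"
    "\<And>s. 0 \<le> s \<Longrightarrow> s < h \<Longrightarrow> X s \<omega> \<noteq> ereal v"
    using first_passage[where X=X and v=v and \<omega>=\<omega>, OF continuous_paths[OF assms(2)] climbs_hit[OF assms(2)]] L by metis
  obtain c T where c: "0 \<le> c" "c < y" and T: "0 \<le> T" "X T \<omega> = ereal v"
    "drawdown_le (\<lambda>t. X t \<omega>) T (ereal c)"
    using L by (auto simp: climbs_def climbs_by_def)
  have "h \<le> T" using h(4)[of T] T by force
  have "h \<le> t" using L h assms(3) by auto
  obtain n where "ereal c \<le> ereal (level_below y n)" using level_below_cofinal[OF c(2)] by auto
  then have "drawdown_le (\<lambda>t. X t \<omega>) h (ereal (level_below y n))"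
    using drawdown_le_mono[OF T(3) \<open>h \<le> T\<close>] by blast
  with h \<open>h \<le> t\<close> show ?R unfolding climbs_by_def by (intro exI[of _ n] bexI[of _ h]) auto
next
  assume ?R
  then obtain n :: nat where n: "climbs_by (\<lambda>t. X t \<omega>) v (ereal (level_below y n)) t" by blast
  then have "climbs (\<lambda>t. X t \<omega>) v y"
    using assms level_below_nonneg level_below_less unfolding climbs_def
    by (intro exI[of _ "level_below y n"] exI[of _ t]) auto
  moreover have "hitting_time X v \<omega> \<le> ennreal t"
    using n hitting_time_le_iff[where X=X and \<omega>=\<omega>, OF continuous_paths[OF assms(2)] assms(3)]
    by (auto simp: climbs_by_def drawdown_le_def)
  ultimately show ?L by blast
qed

lemma climb_event_pre_sigma:
  assumes y: "0 < y"
  shows "climb_event v y \<in> sets (pre_sigma (hitting_time X v))"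
proof (rule sets_pre_sigmaI[OF stopping_time_hitting])
  fix t :: ennreal
  have *: "{\<omega> \<in> climb_event v y. hitting_time X v \<omega> \<le> ennreal r} \<in> sets (F (ennreal r))" if "0 \<le> r" for r
  proof -
    have "{\<omega> \<in> climb_event v y. hitting_time X v \<omega> \<le> ennreal r} =
      (\<Union>n::nat. {\<omega>\<in>space M. climbs_by (\<lambda>t. X t \<omega>) v (ereal (level_below y n)) r})"
      using climbs_and_hit_by_iff_levels[OF y _ that] unfolding climb_event_def by blast
    also have "\<dots> \<in> sets (F (ennreal r))"
      by (intro sets.countable_UN'' climbs_by_F) (use that level_below_nonneg in auto)
    finally show ?thesis .
  qed
  show "{\<omega> \<in> climb_event v y. hitting_time X v \<omega> \<le> t} \<in> sets (F t)"
  proof (cases t)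
    case (real r)
    then show ?thesis using * by simp
  next
    case top
    have "{\<omega> \<in> climb_event v y. hitting_time X v \<omega> \<le> t} =
      (\<Union>n::nat. {\<omega> \<in> climb_event v y. hitting_time X v \<omega> \<le> ennreal (real n)})"
    proof -
      have "\<exists>n::nat. hitting_time X v \<omega> \<le> ennreal (real n)" if "\<omega> \<in> climb_event v y" for \<omega>
      proof -
        have "hitting_time X v \<omega> < top" using that climbs_hit by (auto simp: climb_event_def)
        then obtain r where "0 \<le> r" "hitting_time X v \<omega> = ennreal r"
          by (cases "hitting_time X v \<omega>") auto
        moreover obtain n :: nat where "r \<le> n" using real_arch_simple by blast
        ultimately show ?thesis by (auto intro!: exI[of _ n] ennreal_leI)
      qed
      then show ?thesis by (auto simp: top)
    qed
    also have "\<dots> \<in> sets (F t)"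
    proof (intro sets.countable_UN'')
      fix n :: nat
      show "{\<omega> \<in> climb_event v y. hitting_time X v \<omega> \<le> ennreal (real n)} \<in> sets (F t)"
        using *[of "real n"] sets_F_mono[of "ennreal (real n)" t] top by auto
    qed auto
    finally show ?thesis .
  qed
qed

lemma climb_event_sets:
  assumes y: "0 < y"
  shows "climb_event w y \<in> sets M"
proof -
  have "{\<omega> \<in> climb_event w y. hitting_time X w \<omega> \<le> top} \<in> sets (F top)"
    by (intro sets_pre_sigmaD stopping_time_hitting climb_event_pre_sigma y)
  then show ?thesis by (auto dest: sets_F_le)
qed

lemma PiM_climbs_by:
  "{p \<in> space (\<Pi>\<^sub>M t\<in>{0..}. borel). climbs_by_rat p w c t} \<in> sets (\<Pi>\<^sub>M t\<in>{0::real..}. borel)"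
proof -
  have "{p \<in> space (\<Pi>\<^sub>M t\<in>{0..}. borel). climbs_by_rat (\<lambda>q. p q) w c t} \<in> sets (\<Pi>\<^sub>M t\<in>{0::real..}. borel)"
    by (intro climbs_by_rat_sets measurable_component_singleton) auto
  then show ?thesis by simp
qed

lemma climbs_by_rat_restrict: "climbs_by_rat (\<lambda>t\<in>{0..}. p t) w c t \<longleftrightarrow> climbs_by_rat p w c t"
proof -
  have eq: "restrict p {0..} q = p q" if "q \<in> rat_upto u" for q u
    using that by (auto simp: rat_upto_def)
  have dd: "drawdown_le_rat (restrict p {0..}) q c = drawdown_le_rat p q c" for q
    unfolding drawdown_le_rat_def by (intro ball_cong refl) (simp only: eq)
  show ?thesis
    unfolding climbs_by_rat_def dd by (intro all_cong1 bex_cong refl) (simp only: eq)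
qed

text \<open>At a hitting time the position is deterministic, so the strong Markov property turns into independence of
past and future.\<close>

lemma strong_markov_hitting:
  assumes x: "x \<in> I" and v: "v \<in> I"
    and A: "A \<in> sets (pre_sigma (hitting_time X v))"
    and Af: "\<And>\<omega>. \<omega> \<in> A \<Longrightarrow> hitting_time X v \<omega> < top"
    and B: "B \<in> sets (\<Pi>\<^sub>M t\<in>{0..}. borel)"
  shows "measure (P x) {\<omega>\<in>A. (\<lambda>t\<in>{0..}. X (enn2real (hitting_time X v \<omega>) + t) \<omega>) \<in> B} =
    measure (P x) A * measure (P v) {\<omega>\<in>space M. (\<lambda>t\<in>{0..}. X t \<omega>) \<in> B}"
proof -
  interpret prob_space "P x" by (rule prob_P[OF x])
  interpret v: prob_space "P v" by (rule prob_P[OF v])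
  have AM: "A \<in> sets M"
  proof -
    have "{\<omega>\<in>A. hitting_time X v \<omega> \<le> top} \<in> sets (F top)"
      by (rule sets_pre_sigmaD[OF stopping_time_hitting A])
    then show ?thesis by (auto dest: sets_F_le)
  qed
  then have AP: "A \<in> sets (P x)" using sets_P x by simp
  have at: "X (enn2real (hitting_time X v \<omega>)) \<omega> = ereal v" if "\<omega> \<in> A" for \<omega>
  proof -
    have "\<omega> \<in> space M" using AM that sets.sets_into_space by blast
    from first_passage[where X=X and v=v and \<omega>=\<omega>, OF continuous_paths[OF this] Af[OF that]]
    obtain h where "0 \<le> h" "hitting_time X v \<omega> = ennreal h" "X h \<omega> = ereal v" by metis
    then show ?thesis by simp
  qed
  let ?G = "{\<omega>'\<in>space M. (\<lambda>t\<in>{0..}. X t \<omega>') \<in> B}"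
  have 1: "{\<omega>\<in>A. hitting_time X v \<omega> < top \<and> X (enn2real (hitting_time X v \<omega>)) \<omega> \<in> ereal ` I \<and>
       (\<lambda>t\<in>{0..}. X (enn2real (hitting_time X v \<omega>) + t) \<omega>) \<in> B} =
     {\<omega>\<in>A. (\<lambda>t\<in>{0..}. X (enn2real (hitting_time X v \<omega>) + t) \<omega>) \<in> B}"
    using at Af v by auto
  have 2: "{\<omega>\<in>A. hitting_time X v \<omega> < top \<and> X (enn2real (hitting_time X v \<omega>)) \<omega> \<in> ereal ` I} = A"
    using at Af v by auto
  have "emeasure (P x) {\<omega>\<in>A. (\<lambda>t\<in>{0..}. X (enn2real (hitting_time X v \<omega>) + t) \<omega>) \<in> B} =
    (\<integral>\<^sup>+\<omega>\<in>A. emeasure (P (real_of_ereal (X (enn2real (hitting_time X v \<omega>)) \<omega>))) ?G \<partial>P x)"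
    using strong_markov[OF x stopping_time_hitting A B] unfolding 1 2 .
  also have "\<dots> = (\<integral>\<^sup>+\<omega>. emeasure (P v) ?G * indicator A \<omega> \<partial>P x)"
    using at by (intro nn_integral_cong) (auto split: split_indicator)
  also have "\<dots> = emeasure (P v) ?G * emeasure (P x) A"
    using AP by (simp add: nn_integral_cmult)
  finally show ?thesis
    unfolding measure_def by (simp add: enn2real_mult mult.commute)
qed

text \<open>Once outside \<open>I\<close> the process is frozen, so a path that is in \<open>I\<close> at time \<open>T\<close> has been there all along. In
particular it is finite up to \<open>T\<close>.\<close>

lemma before_inside:
  assumes w: "\<omega> \<in> space M" and s: "0 \<le> s" "s \<le> T" and "X T \<omega> = ereal v" "v \<in> I"
  shows "X s \<omega> \<in> ereal ` I"
  using not_killed_inside[OF w s] assms by fastforce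

lemma pre_sigma_Int_start_le:
  assumes T: "stopping_time F \<tau>" and A: "A \<in> sets (pre_sigma \<tau>)"
  shows "A \<inter> {\<omega>\<in>space M. X 0 \<omega> \<le> ereal v} \<in> sets (pre_sigma \<tau>)"
proof (rule sets_pre_sigmaI[OF T])
  fix t
  have [measurable]: "X 0 \<in> borel_measurable (F t)" by (rule X_measurable_F) auto
  have "{\<omega>\<in>space (F t). X 0 \<omega> \<le> ereal v} \<in> sets (F t)" by measurable
  from sets.Int[OF sets_pre_sigmaD[OF T A] this]
  show "{\<omega> \<in> A \<inter> {\<omega>\<in>space M. X 0 \<omega> \<le> ereal v}. \<tau> \<omega> \<le> t} \<in> sets (F t)"
    by (rule back_subst[where P="\<lambda>A. A \<in> sets (F t)"]) (auto simp: space_F)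
qed

text \<open>The starting point is prescribed only almost surely. Restricting to paths that start at or below \<open>v\<close> turns
almost sure identities between events into exact ones, which settles the measurability of events that
involve the shifted path.\<close>

lemma measure_Int_start_le:
  assumes z: "z \<in> I" "z \<le> v" and A: "A \<in> sets M"
  shows "measure (P z) A = measure (P z) (A \<inter> {\<omega>\<in>space M. X 0 \<omega> \<le> ereal v})"
proof (rule measure_eq_AE)
  have [measurable]: "X 0 \<in> borel_measurable M" by (rule X_measurable) simp
  have "{\<omega>\<in>space M. X 0 \<omega> \<le> ereal v} \<in> sets M" by measurable
  with A sets_P[OF z(1)]
  show "A \<in> sets (P z)" "A \<inter> {\<omega>\<in>space M. X 0 \<omega> \<le> ereal v} \<in> sets (P z)" by auto
  show "AE \<omega> in P z. \<omega> \<in> A \<longleftrightarrow> \<omega> \<in> A \<inter> {\<omega>\<in>space M. X 0 \<omega> \<le> ereal v}"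
    using start[OF z(1)] AE_space by eventually_elim (use z space_P[OF z(1)] in auto)
qed

definition climb_prob :: "real \<Rightarrow> real \<Rightarrow> real \<Rightarrow> real" where
  "climb_prob y z w = measure (P z) (climb_event w y)"

text \<open>The pathwise statement is \<open>climbs_split\<close>, applied at the first visit of \<open>v\<close>.\<close>

lemma climb_prob_mult:
  assumes y: "0 < y" and z: "z \<in> I" and zv: "z \<le> v" and vw: "v \<le> w" and v: "v \<in> I"
  shows "climb_prob y z w = climb_prob y z v * climb_prob y v w"
proof -
  interpret prob_space "P z" by (rule prob_P[OF z])
  define B where "B = (\<Union>n::nat. \<Union>N::nat. {p \<in> space (\<Pi>\<^sub>M t\<in>{0::real..}. borel).
    climbs_by_rat p w (ereal (level_below y n)) N})"
  have Bs: "B \<in> sets (\<Pi>\<^sub>M t\<in>{0::real..}. borel)"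
    unfolding B_def by (intro sets.countable_UN'' PiM_climbs_by) auto
  have B: "(\<lambda>t\<in>{0..}. p t) \<in> B \<longleftrightarrow> climbs p w y" if "continuous_on {0..} p" for p
    using climbs_iff_rat[OF that y, of w]
    by (auto simp: B_def climbs_by_rat_restrict space_PiM)
  let ?S = "{\<omega>\<in>space M. X 0 \<omega> \<le> ereal v}"
  let ?A = "climb_event v y \<inter> ?S"
  have iff: "\<omega> \<in> climb_event w y \<longleftrightarrow>
      \<omega> \<in> climb_event v y \<and> (\<lambda>t\<in>{0..}. X (enn2real (hitting_time X v \<omega>) + t) \<omega>) \<in> B"
    if "\<omega> \<in> ?S" for \<omega>
  proof (cases "hitting_time X v \<omega> < top")
    case True
    from that have M: "\<omega> \<in> space M" and X0: "X 0 \<omega> \<le> ereal v" by auto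
    note cont = continuous_paths[OF M]
    obtain h where h: "0 \<le> h" "hitting_time X v \<omega> = ennreal h" "X h \<omega> = ereal v"
      "\<And>s. 0 \<le> s \<Longrightarrow> s < h \<Longrightarrow> X s \<omega> \<noteq> ereal v"
      using first_passage[where X=X and v=v and \<omega>=\<omega>, OF cont True] by metis
    have "continuous_on {0..} (\<lambda>t. X (h + t) \<omega>)"
      using h by (intro continuous_on_compose2[OF cont] continuous_intros) auto
    note B' = B[OF this]
    have "enn2real (hitting_time X v \<omega>) = h" using h by simp
    then show ?thesis
      using climbs_split[OF cont X0 vw h(1,3,4), of y] M by (simp add: climb_event_def B')
  next
    case False
    note inS = that
    have "\<not> climbs (\<lambda>t. X t \<omega>) w y"
    proof
      assume "climbs (\<lambda>t. X t \<omega>) w y"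
      then obtain T where T: "0 \<le> T" "X T \<omega> = ereal w" by (auto simp: climbs_def climbs_by_def)
      obtain s where "0 \<le> s" "s \<le> T" "X s \<omega> = ereal v"
        by (rule crosses_level[of \<omega> v T]) (use T inS vw in auto)
      then have "hitting_time X v \<omega> \<le> ennreal s" by (intro hitting_time_le)
      with False show False using ennreal_less_top le_less_trans by blast
    qed
    with False show ?thesis using climbs_hit by (auto simp: climb_event_def)
  qed
  have "climb_prob y z w = measure (P z) (climb_event w y \<inter> ?S)"
    unfolding climb_prob_def
    by (rule measure_Int_start_le[OF z zv climb_event_sets[OF y]])
  also have "climb_event w y \<inter> ?S = {\<omega>\<in>?A. (\<lambda>t\<in>{0..}. X (enn2real (hitting_time X v \<omega>) + t) \<omega>) \<in> B}"
    using iff by auto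
  also have "measure (P z) \<dots> = measure (P z) ?A * measure (P v) {\<omega>\<in>space M. (\<lambda>t\<in>{0..}. X t \<omega>) \<in> B}"
    by (intro strong_markov_hitting z v pre_sigma_Int_start_le stopping_time_hitting climb_event_pre_sigma y Bs)
       (auto simp: climb_event_def climbs_hit)
  also have "measure (P z) ?A = measure (P z) (climb_event v y)"
    by (rule measure_Int_start_le[OF z zv climb_event_sets[OF y], symmetric])
  also have "{\<omega>\<in>space M. (\<lambda>t\<in>{0..}. X t \<omega>) \<in> B} = climb_event w y"
    using B[OF continuous_paths] by (auto simp: climb_event_def)
  finally show ?thesis by (simp add: climb_prob_def)
qed


lemma upward_closed:
  assumes "x \<in> I" "x \<le> y"
  shows "y \<in> I"
proof -
  have "ereal y < (SUP z\<in>I. ereal z)" by (simp add: right_endpoint)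
  then obtain z where "z \<in> I" "y < z" by (auto simp: less_SUP_iff)
  with interval(1) assms show ?thesis
    unfolding is_interval_1 by (meson less_imp_le)
qed

lemma above_mem_interior:
  assumes "x \<in> I" "x < y"
  shows "y \<in> interior I"
proof -
  have "{x<..} \<subseteq> I" using upward_closed[OF assms(1)] by auto
  then have "{x<..} \<subseteq> interior I" by (simp add: interior_maximal)
  with assms(2) show ?thesis by auto
qed

lemma interior_upward_closed: "x \<in> interior I \<Longrightarrow> x \<le> y \<Longrightarrow> y \<in> interior I"
  using above_mem_interior[of x y] interior_subset by (cases "x = y") auto

text \<open>Until the first visit of \<open>w\<close> the running maximum is at most \<open>w\<close>. If \<open>w - y\<close> has not been touched by then,
no drawdown of size \<open>y\<close> can have occurred.\<close>

lemma climb_prob_lower: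
  assumes S: "is_scale_function P X I S" and a: "w - y \<in> interior I"
    and y: "0 < y" and z: "w - y < z" "z < w"
  shows "(S z - S (w - y)) / (S w - S (w - y)) \<le> climb_prob y z w"
proof -
  let ?a = "w - y"
  have w: "w \<in> interior I" and zi: "z \<in> interior I"
    using interior_upward_closed[OF a] z by auto
  then have zI: "z \<in> I" and wI: "w \<in> I" using interior_subset by auto
  interpret prob_space "P z" by (rule prob_P[OF zI])
  have "(S z - S ?a) / (S w - S ?a) = \<P>(\<omega> in P z. hitting_time X w \<omega> < hitting_time X ?a \<omega>)"
    using S a w z unfolding is_scale_function_def by simp
  also have "\<dots> \<le> measure (P z) (climb_event w y)"
  proof (rule finite_measure_mono_AE)
    show "climb_event w y \<in> sets (P z)" using climb_event_sets[OF y] sets_P[OF zI] by simp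
    show "AE \<omega> in P z. \<omega> \<in> {\<omega>\<in>space (P z). hitting_time X w \<omega> < hitting_time X ?a \<omega>} \<longrightarrow> \<omega> \<in> climb_event w y"
      using start[OF zI] AE_space
    proof (eventually_elim, intro impI)
      fix \<omega> assume X0: "X 0 \<omega> = ereal z" and sp: "\<omega> \<in> space (P z)"
        and "\<omega> \<in> {\<omega>\<in>space (P z). hitting_time X w \<omega> < hitting_time X ?a \<omega>}"
      then have H: "hitting_time X w \<omega> < hitting_time X ?a \<omega>" by simp
      have M: "\<omega> \<in> space M" using sp space_P[OF zI] by simp
      note cont = continuous_paths[OF M]
      have "hitting_time X w \<omega> < top" using H top.not_eq_extremum by fastforce
      then obtain h where h: "0 \<le> h" "hitting_time X w \<omega> = ennreal h" "X h \<omega> = ereal w"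
        "\<And>s. 0 \<le> s \<Longrightarrow> s < h \<Longrightarrow> X s \<omega> \<noteq> ereal w"
        using first_passage[where X=X and v=w and \<omega>=\<omega>, OF cont] by metis
      have na: "X s \<omega> \<noteq> ereal ?a" if "0 \<le> s" "s \<le> h" for s
      proof
        assume "X s \<omega> = ereal ?a"
        then have "hitting_time X ?a \<omega> \<le> ennreal s" using that by (intro hitting_time_le)
        also have "\<dots> \<le> hitting_time X w \<omega>" using h(2) that by (simp add: ennreal_leI)
        finally show False using H by simp
      qed
      have above: "ereal ?a < X s \<omega>" if "0 \<le> s" "s \<le> h" for s
      proof (cases "s = h")
        case True
        then show ?thesis using h y by simp
      next
        case False
        show ?thesis
          by (rule above_before_first_passage[OF cont, of ?a h]) (use na that False X0 z in auto)
      qed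
      have below: "X s \<omega> \<le> ereal w" if "0 \<le> s" "s \<le> h" for s
        using below_before_first_passage[OF cont _ h(4) that(1)] that h(3) X0 z
        by (cases "s = h") (auto intro: less_imp_le)
      have "climbs (\<lambda>t. X t \<omega>) w y"
      proof (rule climbs_strict[OF cont h(1,3)])
        show "\<bar>X s \<omega>\<bar> \<noteq> \<infinity>" if "0 \<le> s" "s \<le> h" for s
          using before_inside[OF M that h(3) wI] by auto
        show "X s \<omega> < X u \<omega> + ereal y" if "0 \<le> s" "s \<le> u" "u \<le> h" for s u
          using below[of s] above[of u] that by (cases "X s \<omega>"; cases "X u \<omega>") auto
      qed
      then show "\<omega> \<in> climb_event w y" using M by (simp add: climb_event_def)
    qed
  qed
  finally show ?thesis by (simp add: climb_prob_def)
qed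

text \<open>The running maximum is at least the starting point \<open>z\<close>. If \<open>z - y\<close> were touched before \<open>w\<close>, a drawdown of
size \<open>y\<close> would have occurred.\<close>

lemma climb_prob_upper:
  assumes S: "is_scale_function P X I S" and a: "z - y \<in> interior I"
    and y: "0 < y" and z: "z < w"
  shows "climb_prob y z w \<le> (S z - S (z - y)) / (S w - S (z - y))"
proof -
  let ?a = "z - y"
  have w: "w \<in> interior I" and zi: "z \<in> interior I"
    using interior_upward_closed[OF a] z y by auto
  then have zI: "z \<in> I" using interior_subset by auto
  interpret prob_space "P z" by (rule prob_P[OF zI])
  note [measurable] = hitting_time_measurable
  have "measure (P z) (climb_event w y) \<le> \<P>(\<omega> in P z. hitting_time X w \<omega> < hitting_time X ?a \<omega>)"
  proof (rule finite_measure_mono_AE)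
    have "{\<omega>\<in>space M. hitting_time X w \<omega> < hitting_time X ?a \<omega>} \<in> sets M" by measurable
    then show "{\<omega>\<in>space (P z). hitting_time X w \<omega> < hitting_time X ?a \<omega>} \<in> sets (P z)"
      using sets_P[OF zI] space_P[OF zI] by simp
    show "AE \<omega> in P z. \<omega> \<in> climb_event w y \<longrightarrow> \<omega> \<in> {\<omega>\<in>space (P z). hitting_time X w \<omega> < hitting_time X ?a \<omega>}"
      using start[OF zI] AE_space
    proof (eventually_elim, intro impI)
      fix \<omega> assume X0: "X 0 \<omega> = ereal z" and sp: "\<omega> \<in> space (P z)" and "\<omega> \<in> climb_event w y"
      then have M: "\<omega> \<in> space M" and cl: "climbs (\<lambda>t. X t \<omega>) w y" by (auto simp: climb_event_def)
      then obtain c T where c: "0 \<le> c" "c < y" and T: "0 \<le> T" "X T \<omega> = ereal w"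
        "drawdown_le (\<lambda>t. X t \<omega>) T (ereal c)"
        by (auto simp: climbs_def climbs_by_def)
      note cont = continuous_paths[OF M]
      have le: "hitting_time X w \<omega> \<le> ennreal T" using hitting_time_le T by metis
      have "ennreal T < hitting_time X ?a \<omega>"
      proof (rule ccontr)
        assume "\<not> ennreal T < hitting_time X ?a \<omega>"
        then have ha: "hitting_time X ?a \<omega> \<le> ennreal T" by simp
        then have "hitting_time X ?a \<omega> < top" using ennreal_less_top le_less_trans by blast
        then obtain s where s: "0 \<le> s" "hitting_time X ?a \<omega> = ennreal s" "X s \<omega> = ereal ?a"
          using first_passage[where X=X and v="?a" and \<omega>=\<omega>, OF cont] by metis
        have "s \<le> T" using ha s T by simp
        then have "X 0 \<omega> \<le> X s \<omega> + ereal c" using T(3) s(1) unfolding drawdown_le_def by blast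
        with X0 s(3) c show False by simp
      qed
      with le sp show "\<omega> \<in> {\<omega>\<in>space (P z). hitting_time X w \<omega> < hitting_time X ?a \<omega>}" by auto
    qed
  qed
  also have "\<dots> = (S z - S ?a) / (S w - S ?a)"
    using S a w z y unfolding is_scale_function_def by simp
  finally show ?thesis by (simp add: climb_prob_def)
qed

text \<open>Before the first visit of \<open>w\<close> the path lies in \<open>[l, w)\<close>, and this interval is too short for a drawdown of
size \<open>y\<close>. At the moment of the visit the drawdown is \<open>0\<close>. If \<open>x = w\<close>, the visit is immediate.\<close>

lemma climb_prob_no_room:
  assumes y: "0 < y" and x: "x \<in> I" and xw: "x \<le> w" and room: "x = w \<or> ereal w \<le> ereal y + l"
    and hit: "AE \<omega> in P x. hitting_time X w \<omega> < top"
  shows "climb_prob y x w = 1"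
proof -
  interpret prob_space "P x" by (rule prob_P[OF x])
  have wI: "w \<in> I" using upward_closed x xw by blast
  have "AE \<omega> in P x. \<omega> \<in> climb_event w y"
    using hit start[OF x] AE_space
  proof eventually_elim
    fix \<omega> assume hit: "hitting_time X w \<omega> < top" and X0: "X 0 \<omega> = ereal x" and sp: "\<omega> \<in> space (P x)"
    have M: "\<omega> \<in> space M" using sp space_P[OF x] by simp
    note cont = continuous_paths[OF M]
    obtain h where h: "0 \<le> h" "hitting_time X w \<omega> = ennreal h" "X h \<omega> = ereal w"
        "\<And>s. 0 \<le> s \<Longrightarrow> s < h \<Longrightarrow> X s \<omega> \<noteq> ereal w"
      using first_passage[where X=X and v=w and \<omega>=\<omega>, OF cont hit] by metis
    have below: "X s \<omega> < ereal w" if "0 \<le> s" "s < h" for s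
      using below_before_first_passage[OF cont _ h(4) that] X0 xw by auto
    have inside: "X s \<omega> \<in> ereal ` I" if "0 \<le> s" "s \<le> h" for s
      using before_inside[OF M that h(3) wI] .
    have "climbs (\<lambda>t. X t \<omega>) w y"
    proof (rule climbs_strict[OF cont h(1,3)])
      show "\<bar>X s \<omega>\<bar> \<noteq> \<infinity>" if "0 \<le> s" "s \<le> h" for s using inside[OF that] by auto
      show "X s \<omega> < X u \<omega> + ereal y" if su: "0 \<le> s" "s \<le> u" "u \<le> h" for s u
      proof (cases "u = h")
        case True
        have "X s \<omega> \<le> ereal w" using below[of s] su h(3) by (cases "s = h") auto
        also have "\<dots> < ereal w + ereal y" using y by simp
        finally show ?thesis using True h(3) by simp
      next
        case False
        then have "u < h" using su by simp
        then have "x \<noteq> w" using h(4)[of 0] X0 su by auto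
        with room have r: "ereal w \<le> ereal y + l" by simp
        have "X s \<omega> < ereal w" using below[of s] su \<open>u < h\<close> by auto
        also note r
        also have "l \<le> X u \<omega>"
          using inside[of u] su left_endpoint by (auto intro: INF_lower)
        then have "ereal y + l \<le> X u \<omega> + ereal y" by (metis add.commute add_right_mono)
        finally show ?thesis .
      qed
    qed
    then show "\<omega> \<in> climb_event w y" using M by (simp add: climb_event_def)
  qed
  then show ?thesis
    unfolding climb_prob_def using climb_event_sets[OF y] sets_P[OF x] by (simp add: prob_eq_1)
qed

section \<open>Higher levels are hit almost surely\<close>

lemma PiM_hits_by:
  assumes "0 \<le> t"
  obtains B where "B \<in> sets (\<Pi>\<^sub>M t\<in>{0::real..}. borel)"
    "\<And>p. continuous_on {0..} p \<Longrightarrow> (\<lambda>t\<in>{0..}. p t) \<in> B \<longleftrightarrow> (\<exists>s\<in>{0..t}. p s = ereal v)"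
proof (rule that[OF PiM_climbs_by[of v \<infinity> t]])
  fix p :: "real \<Rightarrow> ereal" assume p: "continuous_on {0..} p"
  show "(\<lambda>t\<in>{0..}. p t) \<in> {p \<in> space (\<Pi>\<^sub>M t\<in>{0::real..}. borel). climbs_by_rat p v \<infinity> t} \<longleftrightarrow>
      (\<exists>s\<in>{0..t}. p s = ereal v)"
    using climbs_by_iff_rat[OF p, of \<infinity> t v] assms
    by (simp add: climbs_by_rat_restrict space_PiM climbs_by_def drawdown_le_def)
qed

lemma hitting_time_le_iff_ex:
  assumes "\<omega> \<in> space M" "0 \<le> t"
  shows "hitting_time X v \<omega> \<le> ennreal t \<longleftrightarrow> (\<exists>s\<in>{0..t}. X s \<omega> = ereal v)"
  using hitting_time_le_iff[where X=X and \<omega>=\<omega>, OF continuous_paths[OF assms(1)] assms(2)]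
  by (simp add: climbs_by_def drawdown_le_def)

text \<open>A path from \<open>a\<close> to \<open>\<eta>\<close> visits \<open>z\<close> on its way, and after this visit there is at most time \<open>t\<close> left.\<close>

lemma hit_by_prob_mono:
  assumes a: "a \<in> I" and az: "a \<le> z" and z\<eta>: "z \<le> \<eta>" and t: "0 \<le> t"
  shows "\<P>(\<omega> in P a. hitting_time X \<eta> \<omega> \<le> ennreal t) \<le> \<P>(\<omega> in P z. hitting_time X \<eta> \<omega> \<le> ennreal t)"
proof -
  have z: "z \<in> I" by (rule upward_closed[OF a az])
  interpret prob_space "P a" by (rule prob_P[OF a])
  note [measurable] = hitting_time_measurable
  have [measurable]: "X 0 \<in> borel_measurable M" by (rule X_measurable) simp
  obtain B where B: "B \<in> sets (\<Pi>\<^sub>M t\<in>{0::real..}. borel)"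
    "\<And>p. continuous_on {0..} p \<Longrightarrow> (\<lambda>t\<in>{0..}. p t) \<in> B \<longleftrightarrow> (\<exists>s\<in>{0..t}. p s = ereal \<eta>)"
    using PiM_hits_by[OF t] by metis
  let ?H = "hitting_time X z"
  let ?S = "{\<omega>\<in>space M. X 0 \<omega> \<le> ereal z}"
  let ?A = "{\<omega>\<in>space M. ?H \<omega> < top} \<inter> ?S"
  have "{\<omega>\<in>space M. ?H \<omega> < top} \<in> sets (pre_sigma ?H)"
    using measurable_sets[OF measurable_stopping_time_pre_sigma[OF stopping_time_hitting, of z], of "{..<top}"]
    by (simp add: space_pre_sigma vimage_def Int_def conj_commute)
  then have A: "?A \<in> sets (pre_sigma ?H)"
    by (rule pre_sigma_Int_start_le[OF stopping_time_hitting])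
  have eq: "{\<omega>\<in>?A. (\<lambda>t\<in>{0..}. X (enn2real (?H \<omega>) + t) \<omega>) \<in> B} =
    {\<omega>\<in>space M. X 0 \<omega> \<le> ereal z \<and> ?H \<omega> < top \<and> hitting_time X \<eta> \<omega> \<le> ?H \<omega> + ennreal t}"
  proof -
    have "(\<lambda>t\<in>{0..}. X (enn2real (?H \<omega>) + t) \<omega>) \<in> B \<longleftrightarrow> hitting_time X \<eta> \<omega> \<le> ?H \<omega> + ennreal t"
      if M: "\<omega> \<in> space M" and X0: "X 0 \<omega> \<le> ereal z" and fin: "?H \<omega> < top" for \<omega>
    proof -
      note cont = continuous_paths[OF M]
      obtain h where h: "0 \<le> h" "hitting_time X z \<omega> = ennreal h" "X h \<omega> = ereal z"
          "\<And>s. 0 \<le> s \<Longrightarrow> s < h \<Longrightarrow> X s \<omega> \<noteq> ereal z"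
        using first_passage[where X=X and v=z and \<omega>=\<omega>, OF cont fin] by metis
      have "continuous_on {0..} (\<lambda>t. X (h + t) \<omega>)"
        using h by (intro continuous_on_compose2[OF cont] continuous_intros) auto
      note B' = B(2)[OF this]
      have "(\<exists>s\<in>{0..t}. X (h + s) \<omega> = ereal \<eta>) \<longleftrightarrow> (\<exists>s\<in>{0..h + t}. X s \<omega> = ereal \<eta>)"
      proof
        assume "\<exists>s\<in>{0..h + t}. X s \<omega> = ereal \<eta>"
        then obtain s where s: "0 \<le> s" "s \<le> h + t" "X s \<omega> = ereal \<eta>" by auto
        have "h \<le> s"
        proof (rule ccontr)
          assume "\<not> h \<le> s"
          then have "X s \<omega> < ereal z"
            using below_before_first_passage[OF cont X0 h(4) s(1)] by auto
          with s z\<eta> show False by simp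
        qed
        with s show "\<exists>s\<in>{0..t}. X (h + s) \<omega> = ereal \<eta>" by (intro bexI[of _ "s - h"]) auto
      qed (use h in force)
      then show ?thesis
        using h t hitting_time_le_iff_ex[OF M, of "h + t" \<eta>] by (simp add: B' ennreal_plus)
    qed
    then show ?thesis by auto
  qed
  have "\<P>(\<omega> in P a. hitting_time X \<eta> \<omega> \<le> ennreal t) \<le>
     measure (P a) {\<omega>\<in>?A. (\<lambda>t\<in>{0..}. X (enn2real (?H \<omega>) + t) \<omega>) \<in> B}"
    unfolding eq
  proof (rule finite_measure_mono_AE)
    have "{\<omega>\<in>space M. X 0 \<omega> \<le> ereal z \<and> ?H \<omega> < top \<and> hitting_time X \<eta> \<omega> \<le> ?H \<omega> + ennreal t} \<in> sets M"
      by measurable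
    then show "{\<omega>\<in>space M. X 0 \<omega> \<le> ereal z \<and> ?H \<omega> < top \<and> hitting_time X \<eta> \<omega> \<le> ?H \<omega> + ennreal t} \<in> sets (P a)"
      using sets_P[OF a] by simp
    show "AE \<omega> in P a. \<omega> \<in> {\<omega>\<in>space (P a). hitting_time X \<eta> \<omega> \<le> ennreal t} \<longrightarrow>
      \<omega> \<in> {\<omega>\<in>space M. X 0 \<omega> \<le> ereal z \<and> ?H \<omega> < top \<and> hitting_time X \<eta> \<omega> \<le> ?H \<omega> + ennreal t}"
      using start[OF a] AE_space
    proof (eventually_elim, intro impI)
      fix \<omega> assume X0: "X 0 \<omega> = ereal a" and "\<omega> \<in> space (P a)"
        and "\<omega> \<in> {\<omega>\<in>space (P a). hitting_time X \<eta> \<omega> \<le> ennreal t}"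
      then have M: "\<omega> \<in> space M" and le: "hitting_time X \<eta> \<omega> \<le> ennreal t" using space_P[OF a] by auto
      obtain s where s: "0 \<le> s" "s \<le> t" "X s \<omega> = ereal \<eta>"
        using le hitting_time_le_iff_ex[OF M t] by auto
      obtain r where r: "0 \<le> r" "r \<le> s" "X r \<omega> = ereal z"
        by (rule crosses_level[OF M, of z s]) (use X0 s az z\<eta> in auto)
      then have "?H \<omega> \<le> ennreal r" by (intro hitting_time_le)
      then have "?H \<omega> < top" using ennreal_less_top le_less_trans by blast
      moreover have "hitting_time X \<eta> \<omega> \<le> ?H \<omega> + ennreal t"
        using le by (rule order_trans) simp
      ultimately show "\<omega> \<in> {\<omega>\<in>space M. X 0 \<omega> \<le> ereal z \<and> ?H \<omega> < top \<and> hitting_time X \<eta> \<omega> \<le> ?H \<omega> + ennreal t}"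
        using M X0 az by simp
    qed
  qed
  also have "\<dots> = measure (P a) ?A * measure (P z) {\<omega>\<in>space M. (\<lambda>t\<in>{0..}. X t \<omega>) \<in> B}"
    by (rule strong_markov_hitting[OF a z A _ B(1)]) auto
  also have "\<dots> \<le> 1 * measure (P z) {\<omega>\<in>space M. (\<lambda>t\<in>{0..}. X t \<omega>) \<in> B}"
    by (intro mult_right_mono prob_le_1) auto
  also have "{\<omega>\<in>space M. (\<lambda>t\<in>{0..}. X t \<omega>) \<in> B} = {\<omega>\<in>space (P z). hitting_time X \<eta> \<omega> \<le> ennreal t}"
    using B(2)[OF continuous_paths] hitting_time_le_iff_ex[OF _ t] space_P[OF z] by auto
  finally show ?thesis by simp
qed

lemma events_P: "z \<in> I \<Longrightarrow> {\<omega>\<in>space M. Q \<omega>} \<in> sets M \<Longrightarrow> {\<omega>\<in>space (P z). Q \<omega>} \<in> sets (P z)"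
  using sets_P space_P by simp

lemma hit_by_prob_pos:
  assumes a: "a \<in> I" and \<eta>: "\<eta> \<in> interior I"
  obtains n :: nat where "\<P>(\<omega> in P a. hitting_time X \<eta> \<omega> \<le> ennreal n) > 0"
proof (rule ccontr)
  interpret prob_space "P a" by (rule prob_P[OF a])
  note [measurable] = hitting_time_measurable
  assume "\<not> thesis"
  with that have "\<P>(\<omega> in P a. hitting_time X \<eta> \<omega> \<le> ennreal n) = 0" for n :: nat
    by (meson measure_nonneg not_less order_antisym)
  moreover have "{\<omega>\<in>space (P a). hitting_time X \<eta> \<omega> \<le> ennreal n} \<in> sets (P a)" for n :: nat
    by (rule events_P[OF a]) measurable
  ultimately have "(\<Union>n::nat. {\<omega>\<in>space (P a). hitting_time X \<eta> \<omega> \<le> ennreal n}) \<in> null_sets (P a)"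
    by (intro null_sets_UN) (auto simp: null_sets_def emeasure_eq_measure)
  also have "(\<Union>n::nat. {\<omega>\<in>space (P a). hitting_time X \<eta> \<omega> \<le> ennreal n}) =
    {\<omega>\<in>space (P a). hitting_time X \<eta> \<omega> < top}"
  proof -
    have "hitting_time X \<eta> \<omega> < top \<longleftrightarrow> (\<exists>n::nat. hitting_time X \<eta> \<omega> \<le> ennreal n)" for \<omega>
      by (metis ennreal_less_top ennreal_of_nat_eq_real_of_nat le_less_trans less_imp_le ennreal_Ex_less_of_nat)
    then show ?thesis by auto
  qed
  finally have "\<P>(\<omega> in P a. hitting_time X \<eta> \<omega> < top) = 0"
    by (simp add: null_sets_def measure_def)
  with regular[OF a \<eta>] show False by simp
qed

text \<open>The Markov property at the fixed time \<open>r\<close>. If \<open>\<eta>\<close> has not been hit by then, the path is below \<open>\<eta>\<close>, and it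
is still in \<open>I\<close> because the only exit on that side, \<open>l\<close>, belongs to \<open>I\<close>.\<close>

lemma hitting_tail_step:
  assumes l: "l \<in> ereal ` I" and z: "z \<in> I" "z < \<eta>" and r: "0 \<le> r" and s: "0 \<le> s" and q: "0 \<le> q"
    and tail: "\<And>u. u \<in> I \<Longrightarrow> u < \<eta> \<Longrightarrow> \<P>(\<omega> in P u. ennreal s < hitting_time X \<eta> \<omega>) \<le> q"
  shows "\<P>(\<omega> in P z. ennreal (r + s) < hitting_time X \<eta> \<omega>) \<le>
    q * \<P>(\<omega> in P z. ennreal r < hitting_time X \<eta> \<omega>)"
proof -
  interpret prob_space "P z" by (rule prob_P[OF z(1)])
  note [measurable] = hitting_time_measurable
  have [measurable]: "X 0 \<in> borel_measurable M" by (rule X_measurable) simp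
  have gt_iff: "ennreal t < hitting_time X \<eta> \<omega> \<longleftrightarrow> \<not> (\<exists>s\<in>{0..t}. X s \<omega> = ereal \<eta>)"
    if "\<omega> \<in> space M" "0 \<le> t" for t \<omega>
    using hitting_time_le_iff_ex[OF that, of \<eta>] by (simp add: not_le[symmetric])
  obtain B where B: "B \<in> sets (\<Pi>\<^sub>M t\<in>{0::real..}. borel)"
    "\<And>p. continuous_on {0..} p \<Longrightarrow> (\<lambda>t\<in>{0..}. p t) \<in> B \<longleftrightarrow> (\<exists>t\<in>{0..s}. p t = ereal \<eta>)"
    using PiM_hits_by[OF s, of \<eta>] by metis
  define B' where "B' = space (\<Pi>\<^sub>M t\<in>{0::real..}. borel) - B"
  have B's: "B' \<in> sets (\<Pi>\<^sub>M t\<in>{0::real..}. borel)" unfolding B'_def using B(1) by auto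
  have B': "(\<lambda>t\<in>{0..}. p t) \<in> B' \<longleftrightarrow> \<not> (\<exists>t\<in>{0..s}. p t = ereal \<eta>)"
    if "continuous_on {0..} p" for p
    using B(2)[OF that] by (simp add: B'_def space_PiM)
  let ?S = "{\<omega>\<in>space M. X 0 \<omega> \<le> ereal \<eta>}"
  let ?A = "{\<omega>\<in>space M. ennreal r < hitting_time X \<eta> \<omega>} \<inter> ?S"
  let ?\<tau> = "\<lambda>_::'w. ennreal r"
  have "{\<omega>\<in>space M. ennreal r < hitting_time X \<eta> \<omega>} \<in> sets (pre_sigma ?\<tau>)"
  proof (rule sets_pre_sigmaI[OF stopping_time_const])
    fix t
    have "{\<omega>\<in>space (F (ennreal r)). ennreal r < hitting_time X \<eta> \<omega>} \<in> sets (F (ennreal r))"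
      using stopping_timeD2[OF stopping_time_hitting] unfolding pred_def .
    then show "{\<omega> \<in> {\<omega>\<in>space M. ennreal r < hitting_time X \<eta> \<omega>}. ennreal r \<le> t} \<in> sets (F t)"
      using sets_F_mono[of "ennreal r" t] by (cases "ennreal r \<le> t") (auto simp: space_F)
  qed
  then have A: "?A \<in> sets (pre_sigma ?\<tau>)"
    by (rule pre_sigma_Int_start_le[OF stopping_time_const])
  have inside: "X r \<omega> \<in> ereal ` I \<and> X r \<omega> < ereal \<eta>" if "\<omega> \<in> ?A" for \<omega>
  proof -
    from that have M: "\<omega> \<in> space M" and X0: "X 0 \<omega> \<le> ereal \<eta>"
      and ne: "\<And>t. 0 \<le> t \<Longrightarrow> t \<le> r \<Longrightarrow> X t \<omega> \<noteq> ereal \<eta>"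
      using gt_iff[OF _ r] by auto
    have "X r \<omega> < ereal \<eta>"
    proof (rule ccontr)
      assume "\<not> X r \<omega> < ereal \<eta>"
      then have "ereal \<eta> \<le> X r \<omega>" by simp
      then obtain t where "0 \<le> t" "t \<le> r" "X t \<omega> = ereal \<eta>"
        using crosses_level[OF M X0 _ r] by auto
      with ne[of t] show False by auto
    qed
    moreover have "X r \<omega> \<in> ereal ` I \<union> {l, \<infinity>}" by (rule state_space[OF M r])
    ultimately show ?thesis using l by auto
  qed
  have rest: "{\<omega>'\<in>space M. (\<lambda>t\<in>{0..}. X t \<omega>') \<in> B'} = {\<omega>\<in>space M. ennreal s < hitting_time X \<eta> \<omega>}"
    using B'[OF continuous_paths] gt_iff[OF _ s] by auto
  have eq: "{\<omega>\<in>?A. ?\<tau> \<omega> < top \<and> X (enn2real (?\<tau> \<omega>)) \<omega> \<in> ereal ` I \<and>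
      (\<lambda>t\<in>{0..}. X (enn2real (?\<tau> \<omega>) + t) \<omega>) \<in> B'} =
      {\<omega>\<in>space M. ennreal (r + s) < hitting_time X \<eta> \<omega>} \<inter> ?S" (is "?L = ?R")
  proof -
    have "\<omega> \<in> ?L \<longleftrightarrow> \<omega> \<in> ?R" if M: "\<omega> \<in> space M" and X0: "X 0 \<omega> \<le> ereal \<eta>" for \<omega>
    proof -
      have "continuous_on {0..} (\<lambda>t. X (r + t) \<omega>)"
        using r by (intro continuous_on_compose2[OF continuous_paths[OF M]] continuous_intros) auto
      note B'' = B'[OF this]
      have split: "(\<exists>t\<in>{0..r + s}. X t \<omega> = ereal \<eta>) \<longleftrightarrow>
        (\<exists>t\<in>{0..r}. X t \<omega> = ereal \<eta>) \<or> (\<exists>t\<in>{0..s}. X (r + t) \<omega> = ereal \<eta>)"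
      proof
        assume "\<exists>t\<in>{0..r + s}. X t \<omega> = ereal \<eta>"
        then obtain t where t: "0 \<le> t" "t \<le> r + s" "X t \<omega> = ereal \<eta>" by auto
        show "(\<exists>t\<in>{0..r}. X t \<omega> = ereal \<eta>) \<or> (\<exists>t\<in>{0..s}. X (r + t) \<omega> = ereal \<eta>)"
        proof (cases "t \<le> r")
          case True
          with t show ?thesis by auto
        next
          case False
          with t have "t - r \<in> {0..s}" "X (r + (t - r)) \<omega> = ereal \<eta>" by auto
          then show ?thesis by blast
        qed
      next
        assume "(\<exists>t\<in>{0..r}. X t \<omega> = ereal \<eta>) \<or> (\<exists>t\<in>{0..s}. X (r + t) \<omega> = ereal \<eta>)"
        then show "\<exists>t\<in>{0..r + s}. X t \<omega> = ereal \<eta>"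
        proof
          assume "\<exists>t\<in>{0..s}. X (r + t) \<omega> = ereal \<eta>"
          then obtain t where "0 \<le> t" "t \<le> s" "X (r + t) \<omega> = ereal \<eta>" by auto
          with r show ?thesis by (intro bexI[of _ "r + t"]) auto
        qed (use s in force)
      qed
      have "\<omega> \<in> ?L \<longleftrightarrow> ennreal r < hitting_time X \<eta> \<omega> \<and> X r \<omega> \<in> ereal ` I \<and>
          \<not> (\<exists>t\<in>{0..s}. X (r + t) \<omega> = ereal \<eta>)"
        using M X0 r B'' by simp
      also have "\<dots> \<longleftrightarrow> \<not> (\<exists>t\<in>{0..r + s}. X t \<omega> = ereal \<eta>)"
        unfolding split using inside[of \<omega>] M X0 gt_iff[OF M r] by blast
      also have "\<dots> \<longleftrightarrow> \<omega> \<in> ?R"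
        using M X0 gt_iff[OF M, of "r + s"] r s by simp
      finally show ?thesis .
    qed
    then show ?thesis by blast
  qed
  have AM: "?A \<in> sets M" by measurable
  have "emeasure (P z) ?R =
    (\<integral>\<^sup>+\<omega>\<in>{\<omega>\<in>?A. ?\<tau> \<omega> < top \<and> X (enn2real (?\<tau> \<omega>)) \<omega> \<in> ereal ` I}.
             emeasure (P (real_of_ereal (X (enn2real (?\<tau> \<omega>)) \<omega>)))
               {\<omega>'\<in>space M. (\<lambda>t\<in>{0..}. X t \<omega>') \<in> B'} \<partial>P z)"
    using strong_markov[OF z(1) stopping_time_const A B's] unfolding eq .
  also have "\<dots> \<le> (\<integral>\<^sup>+\<omega>. ennreal q * indicator ?A \<omega> \<partial>P z)"
  proof (rule nn_integral_mono)
    fix \<omega>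
    show "emeasure (P (real_of_ereal (X (enn2real (ennreal r)) \<omega>)))
               {\<omega>'\<in>space M. (\<lambda>t\<in>{0..}. X t \<omega>') \<in> B'} *
        indicator {\<omega>\<in>?A. ennreal r < top \<and> X (enn2real (ennreal r)) \<omega> \<in> ereal ` I} \<omega>
      \<le> ennreal q * indicator ?A \<omega>"
    proof (cases "\<omega> \<in> ?A")
      case True
      then obtain u where u: "u \<in> I" "X r \<omega> = ereal u" "u < \<eta>" using inside[OF True] by auto
      interpret u: prob_space "P u" by (rule prob_P[OF u(1)])
      have "emeasure (P u) {\<omega>'\<in>space M. (\<lambda>t\<in>{0..}. X t \<omega>') \<in> B'} \<le> ennreal q"
        using tail[OF u(1,3)] unfolding rest by (simp add: u.emeasure_eq_measure space_P[OF u(1)] ennreal_leI)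
      then show ?thesis using u(2) r True by (auto simp: indicator_def)
    qed (auto simp: indicator_def)
  qed
  also have "\<dots> = ennreal q * emeasure (P z) ?A"
    using AM sets_P[OF z(1)] by (simp add: nn_integral_cmult)
  also have "\<dots> = ennreal (q * measure (P z) ?A)"
    using q by (simp add: emeasure_eq_measure ennreal_mult)
  finally have "measure (P z) ?R \<le> q * measure (P z) ?A"
    using q by (simp add: emeasure_eq_measure)
  moreover have "measure (P z) {\<omega>\<in>space M. ennreal t < hitting_time X \<eta> \<omega>} =
    measure (P z) ({\<omega>\<in>space M. ennreal t < hitting_time X \<eta> \<omega>} \<inter> ?S)" for t
    using z by (intro measure_Int_start_le) auto
  ultimately show ?thesis using space_P[OF z(1)] by simp
qed

text \<open>Regularity provides a time \<open>n\<close> by which \<open>\<eta>\<close> is hit from \<open>a\<close> with positive probability \<open>c\<close>. The point \<open>a\<close>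
is the worst starting point, so each period of length \<open>n\<close> succeeds with probability at least \<open>c\<close>.\<close>

lemma hits_AE_bottom:
  assumes a: "a \<in> I" "l = ereal a" and x: "x \<in> I" "x < \<eta>"
  shows "AE \<omega> in P x. hitting_time X \<eta> \<omega> < top"
proof -
  note [measurable] = hitting_time_measurable
  have a_le: "a \<le> z" if "z \<in> I" for z
    using INF_lower[OF that, of ereal] a(2) left_endpoint by simp
  interpret a: prob_space "P a" by (rule prob_P[OF a(1)])
  obtain n :: nat where n: "\<P>(\<omega> in P a. hitting_time X \<eta> \<omega> \<le> ennreal n) > 0"
    by (rule hit_by_prob_pos[OF a(1) above_mem_interior[OF x]])
  define c where "c = \<P>(\<omega> in P a. hitting_time X \<eta> \<omega> \<le> ennreal n)"
  have c: "0 < c" "c \<le> 1" using n by (auto simp: c_def)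
  have one: "\<P>(\<omega> in P z. ennreal n < hitting_time X \<eta> \<omega>) \<le> 1 - c" if z: "z \<in> I" "z < \<eta>" for z
  proof -
    interpret prob_space "P z" by (rule prob_P[OF z(1)])
    have "c \<le> \<P>(\<omega> in P z. hitting_time X \<eta> \<omega> \<le> ennreal n)"
      unfolding c_def by (rule hit_by_prob_mono) (use a a_le z in auto)
    moreover have "\<P>(\<omega> in P z. \<not> hitting_time X \<eta> \<omega> \<le> ennreal n) = 1 - \<P>(\<omega> in P z. hitting_time X \<eta> \<omega> \<le> ennreal n)"
      by (rule prob_neg, rule events_P[OF z(1)]) measurable
    ultimately show ?thesis by (simp add: not_le)
  qed
  have geom: "\<P>(\<omega> in P z. ennreal (real k * n) < hitting_time X \<eta> \<omega>) \<le> (1 - c) ^ k"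
    if "z \<in> I" "z < \<eta>" for k z
    using that
  proof (induction k arbitrary: z)
    case 0
    interpret prob_space "P z" by (rule prob_P[OF 0(1)])
    show ?case by simp
  next
    case (Suc k)
    have "\<P>(\<omega> in P z. ennreal (real n + real k * n) < hitting_time X \<eta> \<omega>) \<le>
        (1 - c) ^ k * \<P>(\<omega> in P z. ennreal n < hitting_time X \<eta> \<omega>)"
      by (rule hitting_tail_step) (use a Suc c in auto)
    also have "\<dots> \<le> (1 - c) ^ k * (1 - c)"
      using c one[OF Suc.prems] by (intro mult_left_mono) auto
    finally show ?case by (simp only: of_nat_Suc distrib_right mult_1_left power_Suc2)
  qed
  interpret prob_space "P x" by (rule prob_P[OF x(1)])
  have "\<P>(\<omega> in P x. hitting_time X \<eta> \<omega> = top) \<le> (1 - c) ^ k" for k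
  proof -
    have "\<P>(\<omega> in P x. hitting_time X \<eta> \<omega> = top) \<le> \<P>(\<omega> in P x. ennreal (real k * n) < hitting_time X \<eta> \<omega>)"
    proof (rule finite_measure_mono)
      show "{\<omega>\<in>space (P x). ennreal (real k * n) < hitting_time X \<eta> \<omega>} \<in> sets (P x)"
        by (rule events_P[OF x(1)]) measurable
    qed auto
    also note geom[OF x]
    finally show ?thesis .
  qed
  moreover have "(\<lambda>k. (1 - c) ^ k) \<longlonglongrightarrow> 0" using c by (intro LIMSEQ_realpow_zero) auto
  ultimately have "\<P>(\<omega> in P x. hitting_time X \<eta> \<omega> = top) \<le> 0"
    by (intro LIMSEQ_le_const) auto
  then have "\<P>(\<omega> in P x. hitting_time X \<eta> \<omega> = top) = 0"
    by (meson measure_nonneg order_antisym)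
  moreover have "{\<omega>\<in>space (P x). hitting_time X \<eta> \<omega> = top} \<in> sets (P x)"
    by (rule events_P[OF x(1)]) measurable
  ultimately have "AE \<omega> in P x. \<not> hitting_time X \<eta> \<omega> = top"
    by (subst (asm) prob_eq_0) (auto elim!: AE_mp intro!: AE_I2)
  then show ?thesis by eventually_elim (simp add: less_top)
qed

text \<open>The probability of reaching \<open>\<eta>\<close> before \<open>a\<close> is \<open>1 - (S \<eta> - S x) / (S \<eta> - S a)\<close>, which tends to \<open>1\<close> as
\<open>S a\<close> tends to \<open>-\<infinity>\<close>.\<close>

lemma hits_AE_scale:
  assumes S: "is_scale_function P X I S" and left: "scale_left I S = -\<infinity>"
    and x: "x \<in> interior I" "x < \<eta>"
  shows "AE \<omega> in P x. hitting_time X \<eta> \<omega> < top"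
proof -
  have xI: "x \<in> I" and \<eta>: "\<eta> \<in> interior I" using x interior_subset interior_upward_closed[of x \<eta>] by auto
  interpret prob_space "P x" by (rule prob_P[OF xI])
  note [measurable] = hitting_time_measurable
  have mono: "strict_mono_on (interior I) S" using S by (simp add: is_scale_function_def)
  have S\<eta>: "S x < S \<eta>" using mono x \<eta> by (auto simp: strict_mono_on_def)
  have ms: "{\<omega>\<in>space (P x). hitting_time X \<eta> \<omega> < top} \<in> sets (P x)"
    by (rule events_P[OF xI]) measurable
  have "1 - \<P>(\<omega> in P x. hitting_time X \<eta> \<omega> < top) \<le> 0"
  proof (rule field_le_epsilon)
    fix e :: real assume e: "0 < e"
    \<comment> \<open>Below \<open>S x\<close> to have \<open>a < x\<close>; below the second value to make the exit probability at least \<open>1 - e\<close>.\<close>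
    let ?b = "min (S x) (S \<eta> - (S \<eta> - S x) / e)"
    have "(INF z\<in>interior I. ereal (S z)) < ereal ?b" using left by (simp add: scale_left_def)
    then obtain a where "a \<in> interior I" "ereal (S a) < ereal ?b" unfolding INF_less_iff by blast
    then have a: "a \<in> interior I" "S a < ?b" unfolding less_ereal.simps by auto
    have "a < x"
    proof (rule ccontr)
      assume "\<not> a < x"
      then have "S x \<le> S a" using mono x(1) a(1) by (cases "x = a") (auto simp: strict_mono_on_def less_eq_real_def)
      with a(2) show False by simp
    qed
    have "(S \<eta> - S x) / e < S \<eta> - S a" using a(2) by simp
    then have "(S \<eta> - S x) / (S \<eta> - S a) \<le> e" using e a(2) S\<eta> by (simp add: field_simps)
    moreover have "(S x - S a) / (S \<eta> - S a) = 1 - (S \<eta> - S x) / (S \<eta> - S a)"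
      using a(2) S\<eta> by (simp add: field_simps)
    moreover have "(S x - S a) / (S \<eta> - S a) = \<P>(\<omega> in P x. hitting_time X \<eta> \<omega> < hitting_time X a \<omega>)"
      using S a x \<eta> \<open>a < x\<close> by (auto simp: is_scale_function_def)
    moreover have "\<dots> \<le> \<P>(\<omega> in P x. hitting_time X \<eta> \<omega> < top)"
      by (rule finite_measure_mono[OF _ ms]) (auto simp: less_top intro: order.strict_trans2)
    ultimately show "1 - \<P>(\<omega> in P x. hitting_time X \<eta> \<omega> < top) \<le> 0 + e" by simp
  qed
  then have "\<P>(\<omega> in P x. hitting_time X \<eta> \<omega> < top) = 1"
    using prob_le_1[of "{\<omega>\<in>space (P x). hitting_time X \<eta> \<omega> < top}"] by simp
  then show ?thesis using prob_Collect_eq_1[OF ms] by simp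
qed

section \<open>The law of the maximum drawdown\<close>

lemma hits_start_AE:
  assumes "x \<in> I"
  shows "AE \<omega> in P x. hitting_time X x \<omega> < top"
  using start[OF assms]
proof eventually_elim
  case (elim \<omega>)
  then have "hitting_time X x \<omega> \<le> ennreal 0" by (intro hitting_time_le) auto
  then show ?case using ennreal_less_top le_less_trans by blast
qed

text \<open>An endpoint \<open>l \<in> I\<close> calls for \<open>hits_AE_bottom\<close>: the exit probabilities of the scale function say nothing about
paths that start at \<open>l\<close>.\<close>

lemma hits_AE:
  assumes S: "is_scale_function P X I S" and cls: "scale_left I S = -\<infinity> \<or> l \<in> ereal ` I"
    and x: "x \<in> I" and x\<eta>: "x \<le> \<eta>"
  shows "AE \<omega> in P x. hitting_time X \<eta> \<omega> < top"
proof (cases "x = \<eta>")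
  case True
  then show ?thesis using hits_start_AE[OF x] by simp
next
  case False
  then have lt: "x < \<eta>" using x\<eta> by simp
  show ?thesis
  proof (cases "l \<in> ereal ` I")
    case True
    then show ?thesis using hits_AE_bottom[OF _ _ x lt] by auto
  next
    case False
    have "l \<le> ereal x" unfolding left_endpoint using x by (rule INF_lower)
    with False x have "l < ereal x" by (auto simp: less_le)
    then obtain u where "u \<in> I" "u < x" unfolding left_endpoint INF_less_iff by auto
    then have "x \<in> interior I" by (rule above_mem_interior)
    then show ?thesis using hits_AE_scale[OF S _ _ lt] cls False by auto
  qed
qed

text \<open>The two events agree where \<open>\<eta>\<close> is hit. On the exceptional null set the convention \<open>enn2real top = 0\<close> makes
the drawdown event depend on \<open>X 0\<close> only, which is needed for its measurability.\<close>

lemma max_drawdown_prob_eq_climb_prob: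
  assumes x: "x \<in> I" and \<eta>: "\<eta> \<in> I" and y: "0 < y"
    and hit: "AE \<omega> in P x. hitting_time X \<eta> \<omega> < top"
  shows "\<P>(\<omega> in P x. max_drawdown X (enn2real (hitting_time X \<eta> \<omega>)) \<omega> < ereal y) = climb_prob y x \<eta>"
proof -
  note [measurable] = hitting_time_measurable
  have [measurable]: "X 0 \<in> borel_measurable M" by (rule X_measurable) simp
  let ?D = "{\<omega>\<in>space (P x). max_drawdown X (enn2real (hitting_time X \<eta> \<omega>)) \<omega> < ereal y}"
  have fin: "max_drawdown X (enn2real (hitting_time X \<eta> \<omega>)) \<omega> < ereal y \<longleftrightarrow> \<omega> \<in> climb_event \<eta> y"
    if M: "\<omega> \<in> space M" and H: "hitting_time X \<eta> \<omega> < top" for \<omega>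
  proof -
    obtain h where h: "0 \<le> h" "hitting_time X \<eta> \<omega> = ennreal h" "X h \<omega> = ereal \<eta>"
      "\<And>s. 0 \<le> s \<Longrightarrow> s < h \<Longrightarrow> X s \<omega> \<noteq> ereal \<eta>"
      using first_passage[where X=X and v=\<eta> and \<omega>=\<omega>, OF continuous_paths[OF M] H] by metis
    have "\<bar>X s \<omega>\<bar> \<noteq> \<infinity>" if "0 \<le> s" "s \<le> h" for s
      using before_inside[OF M that h(3) \<eta>] by auto
    then show ?thesis
      using max_drawdown_less_iff[where X=X and \<omega>=\<omega>, OF continuous_paths[OF M] h(1,3,4), of y] M h(1,2)
      by (simp add: climb_event_def)
  qed
  have inf: "max_drawdown X (enn2real (hitting_time X \<eta> \<omega>)) \<omega> < ereal y \<longleftrightarrow> \<bar>X 0 \<omega>\<bar> \<noteq> \<infinity>"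
    if H: "\<not> hitting_time X \<eta> \<omega> < top" for \<omega>
  proof -
    have "hitting_time X \<eta> \<omega> = top" using H by (simp add: not_less top_unique)
    then have "max_drawdown X (enn2real (hitting_time X \<eta> \<omega>)) \<omega> = X 0 \<omega> - X 0 \<omega>"
      by (simp add: max_drawdown_def running_max_def)
    then show ?thesis using y by (cases "X 0 \<omega>") auto
  qed
  have "?D = climb_event \<eta> y \<union> {\<omega>\<in>space M. \<not> hitting_time X \<eta> \<omega> < top \<and> \<bar>X 0 \<omega>\<bar> \<noteq> \<infinity>}"
  proof -
    have "\<omega> \<in> ?D \<longleftrightarrow> \<omega> \<in> climb_event \<eta> y \<union> {\<omega>\<in>space M. \<not> hitting_time X \<eta> \<omega> < top \<and> \<bar>X 0 \<omega>\<bar> \<noteq> \<infinity>}"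
      if "\<omega> \<in> space M" for \<omega>
      using that fin[OF that] inf[of \<omega>] climbs_hit[OF that, of \<eta> y] space_P[OF x]
      by (simp add: climb_event_def) argo
    then show ?thesis using space_P[OF x] by (auto simp: climb_event_def)
  qed
  moreover have "{\<omega>\<in>space M. \<not> hitting_time X \<eta> \<omega> < top \<and> \<bar>X 0 \<omega>\<bar> \<noteq> \<infinity>} \<in> sets M" by measurable
  ultimately have D: "?D \<in> sets (P x)" using climb_event_sets[OF y] sets_P[OF x] by auto
  show ?thesis
    unfolding climb_prob_def
  proof (rule measure_eq_AE)
    show "AE \<omega> in P x. \<omega> \<in> ?D \<longleftrightarrow> \<omega> \<in> climb_event \<eta> y"
      using hit AE_space by eventually_elim (use fin space_P[OF x] in auto)
  qed (use D climb_event_sets[OF y] sets_P[OF x] in auto)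
qed

text \<open>The lower bound for \<open>g(c, w)\<close> uses the point \<open>w - y\<close>, which lies in the interior for every \<open>w > c\<close>. As \<open>w\<close>
decreases to \<open>c\<close>, the values \<open>S (w - y)\<close> may diverge to \<open>-\<infinity>\<close>; they stay below \<open>S u\<close> for a fixed interior
point \<open>u < c\<close>, and this suffices for \<open>g(c, w) \<rightarrow> 1\<close>.\<close>

lemma climb_prob_eq:
  assumes S: "is_scale_function P X I S" and C1: "S C1_differentiable_on interior I"
    and hit: "\<And>z w. z \<in> I \<Longrightarrow> z \<le> w \<Longrightarrow> AE \<omega> in P z. hitting_time X w \<omega> < top"
    and y: "0 < y" and c: "c \<in> interior I" "c \<le> \<eta>"
    and room: "\<And>z. c < z \<Longrightarrow> z - y \<in> interior I"
  shows "climb_prob y c \<eta> = exp_neg (\<integral>\<^sup>+z\<in>{c..\<eta>}. 1 / ennreal (S z - S (z - y)) \<partial>scale_stieltjes I S)"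
proof -
  let ?U = "interior I"
  let ?f = "\<lambda>z. deriv S z / (S z - S (z - y))"
  have mono: "strict_mono_on ?U S" using S by (simp add: is_scale_function_def)
  have Sless: "S u < S v" if "u \<in> ?U" "u < v" for u v
    using mono that interior_upward_closed[of u v] by (auto simp: strict_mono_on_def)
  have cS: "continuous_on ?U S" using S by (simp add: is_scale_function_def)
  have cI: "c \<in> I" using c interior_subset by auto
  have up: "z \<in> ?U" "z \<in> I" if "c \<le> z" for z
    using interior_upward_closed[OF c(1) that] interior_subset by auto
  have prob_le: "climb_prob y z w \<le> 1" if "c \<le> z" for z w
  proof -
    interpret prob_space "P z" by (rule prob_P[OF up(2)[OF that]])
    show ?thesis by (simp add: climb_prob_def)
  qed
  have prob0: "0 \<le> climb_prob y z w" for z w by (simp add: climb_prob_def)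
  have self: "climb_prob y z z = 1" if "c \<le> z" for z
    using climb_prob_no_room[OF y up(2)[OF that] order_refl] hit[OF up(2)[OF that] order_refl] by simp
  have lower: "1 - (S w - S z) / (S w - S (w - y)) \<le> climb_prob y z w" if "c \<le> z" "z < w" "w < z + y" for z w
  proof -
    have a: "w - y \<in> ?U" using room that by simp
    have "S (w - y) < S w" using Sless[OF a] y by simp
    then have "1 - (S w - S z) / (S w - S (w - y)) = (S z - S (w - y)) / (S w - S (w - y))"
      by (simp add: field_simps)
    with climb_prob_lower[OF S a y _ that(2)] that show ?thesis by simp
  qed
  have upper: "climb_prob y z w \<le> 1 - (S w - S z) / (S w - S (z - y))" if "c < z" "z < w" for z w
  proof -
    have a: "z - y \<in> ?U" using room that by simp
    have "S (z - y) < S w" using Sless[OF a] y that by simp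
    then have "1 - (S w - S z) / (S w - S (z - y)) = (S z - S (z - y)) / (S w - S (z - y))"
      by (simp add: field_simps)
    with climb_prob_upper[OF S a y that(2)] show ?thesis by simp
  qed
  have rhs: "(\<integral>\<^sup>+z\<in>{c..\<eta>}. 1 / ennreal (S z - S (z - y)) \<partial>scale_stieltjes I S) =
    (\<integral>\<^sup>+z. ennreal (?f z) * indicator {c<..\<eta>} z \<partial>lborel)"
    by (rule stieltjes_integral_eq[OF C1 mono y]) (use up room in auto)
  show ?thesis
  proof (cases "c = \<eta>")
    case True
    then show ?thesis using self[OF c(2)] unfolding rhs by (simp add: exp_neg_def)
  next
    case False
    with c have c\<eta>: "c < \<eta>" by simp
    define w where "w n = c + (\<eta> - c) / Suc n" for n :: nat
    have w: "c < w n" "w n \<le> \<eta>" for n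
      using c\<eta> divide_left_mono[of 1 "real (Suc n)" "\<eta> - c"] by (simp_all add: w_def)
    have w_lim: "w \<longlonglongrightarrow> c"
    proof -
      have "w \<longlonglongrightarrow> c + 0"
        unfolding w_def by (intro tendsto_intros LIMSEQ_Suc[OF lim_const_over_n])
      then show ?thesis by simp
    qed
    define A where "A n = integral {w n..\<eta>} ?f" for n
    have sub: "{w n - y..\<eta>} \<subseteq> ?U" for n
      using interior_upward_closed[OF room[OF w(1)[of n]]] by auto
    have f: "continuous_on {c<..\<eta>} ?f"
    proof (intro continuous_intros ballI)
      show "continuous_on {c<..\<eta>} (deriv S)"
        by (rule continuous_on_subset[OF C1_deriv_continuous[OF C1]]) (use up in auto)
      show "continuous_on {c<..\<eta>} S"
        by (rule continuous_on_subset[OF cS]) (use up in auto)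
      show "continuous_on {c<..\<eta>} (\<lambda>z. S (z - y))"
        by (intro continuous_on_compose2[OF cS] continuous_intros) (use room in auto)
      show "S z - S (z - y) \<noteq> 0" if "z \<in> {c<..\<eta>}" for z
        using Sless[OF room, of z z] that y by auto
    qed
    note dnn = C1_mono_deriv_nonneg[OF C1 mono]
    have fnn: "0 \<le> ?f z" if "z \<in> {c<..\<eta>}" for z
      using dnn[OF up(1)[of z]] Sless[OF room, of z z] that y by (intro divide_nonneg_nonneg) auto
    have A0: "0 \<le> A n" for n
      unfolding A_def using fnn w[of n]
      by (intro integral_nonneg integrable_continuous_real continuous_on_subset[OF f]) auto
    have exp_A: "climb_prob y (w n) \<eta> = exp (- A n)" for n
      unfolding A_def
    proof (rule exp_decay_from_increments[where G="climb_prob y", OF w(2) y])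
      show "(S has_real_derivative deriv S z) (at z)" if "z \<in> {w n..\<eta>}" for z
        using C1_deriv[OF C1 up(1)[of z]] that w[of n] by auto
      show "continuous_on {w n..\<eta>} (deriv S)"
        by (rule continuous_on_subset[OF C1_deriv_continuous[OF C1]]) (use up w[of n] in auto)
      show "continuous_on {w n - y..\<eta>} S" by (rule continuous_on_subset[OF cS sub])
      show "strict_mono_on {w n - y..\<eta>} S" 
        using mono subsetD[OF sub[of n]] by (simp add: strict_mono_on_def)
      show "climb_prob y (w n) v = climb_prob y (w n) z * climb_prob y z v"
        if "w n \<le> z" "z \<le> v" "v \<le> \<eta>" for z v
        using climb_prob_mult[OF y up(2) that(1,2) up(2)] that w[of n] by simp
    qed (use self prob0 prob_le lower upper w[of n] in auto)
    have "(\<lambda>n. ennreal (A n)) \<longlonglongrightarrow> (\<integral>\<^sup>+z. ennreal (?f z) * indicator {c<..\<eta>} z \<partial>lborel)"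
      unfolding A_def w_def by (rule integral_left_limit[OF c\<eta> f fnn])
    from exp_neg_limit[OF A0 this]
    have lim1: "(\<lambda>n. climb_prob y (w n) \<eta>) \<longlonglongrightarrow>
        exp_neg (\<integral>\<^sup>+z. ennreal (?f z) * indicator {c<..\<eta>} z \<partial>lborel)"
      unfolding exp_A .
    have lim2: "(\<lambda>n. climb_prob y c (w n)) \<longlonglongrightarrow> 1"
    proof -
      obtain e where e: "0 < e" "ball c e \<subseteq> ?U"
        using open_contains_ball[of ?U] c(1) by auto
      \<comment> \<open>Any interior point in \<open>(c - y, c)\<close> serves: eventually \<open>w n - y < u < c\<close>.\<close>
      define u where "u = c - min e y / 2"
      have u: "u \<in> ?U" "u < c" "c - y < u"
      proof -
        have "u \<in> ball c e" using e(1) y by (auto simp: u_def dist_real_def)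
        then show "u \<in> ?U" using e(2) by auto
        show "u < c" "c - y < u" using e(1) y by (auto simp: u_def)
      qed
      have Su: "S u < S c" by (rule Sless[OF u(1,2)])
      have near: "\<forall>\<^sub>F n in sequentially. w n < u + y"
        using w_lim u(3) by (intro order_tendstoD) auto
      have S_lim: "(\<lambda>n. S (w n)) \<longlonglongrightarrow> S c"
        by (rule continuous_on_tendsto_compose[OF cS w_lim c(1)]) (intro always_eventually allI up(1) less_imp_le w(1))
      show ?thesis
      proof (rule tendsto_sandwich)
        show "\<forall>\<^sub>F n in sequentially. 1 - (S (w n) - S c) / (S c - S u) \<le> climb_prob y c (w n)"
          using near
        proof eventually_elim
          case (elim n)
          have a: "w n - y \<in> ?U" by (rule room[OF w(1)])
          have "S (w n - y) < S u" using Sless[OF a] elim by simp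
          moreover have "S c < S (w n)" by (rule Sless[OF c(1) w(1)])
          ultimately have "(S (w n) - S c) / (S (w n) - S (w n - y)) \<le> (S (w n) - S c) / (S c - S u)"
            using Su by (intro divide_left_mono mult_pos_pos) auto
          moreover have "1 - (S (w n) - S c) / (S (w n) - S (w n - y)) \<le> climb_prob y c (w n)"
            using lower[of c "w n"] w[of n] elim u by simp
          ultimately show ?case by simp
        qed
        show "\<forall>\<^sub>F n in sequentially. climb_prob y c (w n) \<le> 1" using prob_le by simp
        have "(\<lambda>n. 1 - (S (w n) - S c) / (S c - S u)) \<longlonglongrightarrow> 1 - (S c - S c) / (S c - S u)"
          using Su by (intro tendsto_intros S_lim) auto
        then show "(\<lambda>n. 1 - (S (w n) - S c) / (S c - S u)) \<longlonglongrightarrow> 1" by simp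
      qed simp
    qed
    have "climb_prob y c \<eta> = climb_prob y c (w n) * climb_prob y (w n) \<eta>" for n
      using climb_prob_mult[OF y cI _ w(2) up(2)] w[of n] by simp
    then have "(\<lambda>n. climb_prob y c \<eta>) \<longlonglongrightarrow>
        1 * exp_neg (\<integral>\<^sup>+z. ennreal (?f z) * indicator {c<..\<eta>} z \<partial>lborel)"
      using tendsto_mult[OF lim2 lim1] by simp
    then show ?thesis unfolding rhs by (simp add: LIMSEQ_const_iff)
  qed
qed

end

theorem theorem3p6:
  fixes M :: "'w measure"
    and F :: "ennreal \<Rightarrow> 'w measure"
    and P :: "real \<Rightarrow> 'w measure"
    and X :: "real \<Rightarrow> 'w \<Rightarrow> ereal"
    and I :: "real set"
    and l :: ereal
    and S :: "real \<Rightarrow> real"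
    and m :: "real measure"
    and x \<eta> :: real
  assumes "ito_mckean_diffusion M F P X I l"
    and "is_scale_function P X I S"
    and "S C1_differentiable_on interior I"
    and "is_speed_measure P X I l S m"
    and "has_continuous_density I m"
    and "class1 P X I l S m \<or> class2 P X I l S m"
    and "x \<in> I" and "x < \<eta>"
  shows "(AE \<omega> in P x. hitting_time X \<eta> \<omega> < top) \<and>
    (\<forall>y::real. 0 \<le> y \<and> ereal y \<le> ereal \<eta> - l \<longrightarrow>
       \<P>(\<omega> in P x. max_drawdown X (enn2real (hitting_time X \<eta> \<omega>)) \<omega> < ereal y) =
       exp_neg (\<integral>\<^sup>+z\<in>{z. max (ereal x) (ereal y + l) \<le> ereal z \<and> z \<le> \<eta>}.
                  1 / ennreal (S z - S (z - y)) \<partial>scale_stieltjes I S))"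
proof -
  interpret ito_mckean_diffusion M F P X I l by fact
  note S = assms(2) and C1 = assms(3) and x = assms(7) and x\<eta> = assms(8)
  have "scale_left I S = -\<infinity> \<or> l \<in> ereal ` I"
    using assms(6) by (auto simp: class1_def class2_def reflecting_def)
  note hit = hits_AE[OF S this]
  have lx: "l \<le> ereal x" unfolding left_endpoint using x by (rule INF_lower)
  have \<eta>I: "\<eta> \<in> I" using upward_closed[OF x] x\<eta> by simp
  have above_l: "z \<in> interior I" if "l < ereal z" for z
  proof -
    from that obtain u where "u \<in> I" "u < z" unfolding left_endpoint INF_less_iff by auto
    then show ?thesis by (rule above_mem_interior)
  qed
  have "\<P>(\<omega> in P x. max_drawdown X (enn2real (hitting_time X \<eta> \<omega>)) \<omega> < ereal y) =
       exp_neg (\<integral>\<^sup>+z\<in>{z. max (ereal x) (ereal y + l) \<le> ereal z \<and> z \<le> \<eta>}.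
                  1 / ennreal (S z - S (z - y)) \<partial>scale_stieltjes I S)"
    if y0: "0 \<le> y" and y\<eta>: "ereal y \<le> ereal \<eta> - l" for y
  proof (cases "y = 0")
    case True
    have "\<not> max_drawdown X (enn2real (hitting_time X \<eta> \<omega>)) \<omega> < 0" for \<omega>
    proof -
      have "0 \<le> running_max X 0 \<omega> - X 0 \<omega>"
        by (cases "X 0 \<omega>") (auto simp: running_max_def)
      also have "\<dots> \<le> max_drawdown X (enn2real (hitting_time X \<eta> \<omega>)) \<omega>"
        unfolding max_drawdown_def by (rule SUP_upper) auto
      finally show ?thesis by simp
    qed
    then have "\<P>(\<omega> in P x. max_drawdown X (enn2real (hitting_time X \<eta> \<omega>)) \<omega> < ereal y) = 0"
      using True by (simp add: zero_ereal_def)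
    moreover have "{z. max (ereal x) (ereal y + l) \<le> ereal z \<and> z \<le> \<eta>} = {x..\<eta>}"
      using True lx by (auto simp: max_absorb1 zero_ereal_def[symmetric])
    moreover have "(\<integral>\<^sup>+z\<in>{x..\<eta>}. 1 / ennreal (S z - S z) \<partial>scale_stieltjes I S) = top"
      using S above_mem_interior[OF x]
      by (intro stieltjes_integral_diverges[OF C1 _ x\<eta>]) (auto simp: is_scale_function_def)
    ultimately show ?thesis using True by (simp add: exp_neg_def)
  next
    case False
    with y0 have y: "0 < y" by simp
    \<comment> \<open>The maximum is finite because \<open>l \<le> x\<close>; if \<open>l = -\<infinity>\<close> then it is \<open>x\<close>.\<close>
    define c where "c = real_of_ereal (max (ereal x) (ereal y + l))"
    have c: "ereal c = max (ereal x) (ereal y + l)"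
      unfolding c_def using lx by (cases l) (auto simp: max_def)
    have set_eq: "{z. max (ereal x) (ereal y + l) \<le> ereal z \<and> z \<le> \<eta>} = {c..\<eta>}"
      unfolding c[symmetric] by auto
    have xc: "x \<le> c" using c by (metis ereal_less_eq(3) max.cobounded1)
    have c\<eta>: "c \<le> \<eta>"
    proof -
      have "ereal y + l \<le> ereal \<eta>" using y\<eta> lx by (cases l) auto
      then have "ereal c \<le> ereal \<eta>" unfolding c using x\<eta> by simp
      then show ?thesis by simp
    qed
    have lc: "ereal y + l \<le> ereal c" unfolding c by simp
    have cint: "c \<in> interior I"
    proof (rule above_l)
      show "l < ereal c" using lc y lx by (cases l) auto
    qed
    have room: "z - y \<in> interior I" if "c < z" for z
    proof (rule above_l)
      show "l < ereal (z - y)" using lc that lx by (cases l) auto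
    qed
    have one: "climb_prob y x c = 1"
    proof (rule climb_prob_no_room[OF y x xc])
      show "x = c \<or> ereal c \<le> ereal y + l"
        using c by (auto simp: max_def split: if_splits)
    qed (rule hit[OF x xc])
    have "\<P>(\<omega> in P x. max_drawdown X (enn2real (hitting_time X \<eta> \<omega>)) \<omega> < ereal y) = climb_prob y x \<eta>"
      by (rule max_drawdown_prob_eq_climb_prob[OF x \<eta>I y hit[OF x less_imp_le[OF x\<eta>]]])
    also have "\<dots> = climb_prob y c \<eta>"
      using climb_prob_mult[OF y x xc c\<eta>] cint interior_subset one by auto
    also have "\<dots> = exp_neg (\<integral>\<^sup>+z\<in>{c..\<eta>}. 1 / ennreal (S z - S (z - y)) \<partial>scale_stieltjes I S)"
      by (rule climb_prob_eq[OF S C1 hit y cint c\<eta> room])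
    finally show ?thesis unfolding set_eq .
  qed
  then show ?thesis using hit[OF x] x\<eta> by auto
qed

end
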